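(* Let $\Omega$ be a nonempty open bounded subset of $\mathbb{R}^n$ and let $0<s<1<p$ with $sp=n$. Let $f:\mathbb{R}^+\to\mathbb{R}^+$ be any Borel measurable function such that $f(t)\to\infty$ as $t\to\infty$, and let $\ell>0$ be arbitrary. Then $$\sup_{u\in\tilde W^{s,p}_0(\Omega),\ [u]_{s,p,\mathbb{R}^n}\le1}\ \int_\Omega f(|u|)\,e^{\alpha^*_{s,n}|u(x)|^{\frac{n}{n-s}}}\,dx=\infty$$ and $$\sup_{u\in W^{s,p}(\mathbb{R}^n),\ \ell\|u\|_{L^p(\mathbb{R}^n)}^p+[u]^p_{s,p,\mathbb{R}^n}\le1}\ \int_{\mathbb{R}^n} f(|u|)\,\Psi\big(\alpha^*_{s,n}|u(x)|^{\frac{n}{n-s}}\big)\,dx=\infty.$$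
   Context: Here $\mathbb{R}^+=[0,\infty)$. $[u]_{s,p,\mathbb{R}^n}=\Big(\int_{\mathbb{R}^n}\int_{\mathbb{R}^n}\frac{|u(x)-u(y)|^p}{|x-y|^{n+sp}}dx\,dy\Big)^{1/p}$, and $W^{s,p}(\mathbb{R}^n)=\{u\in L^p(\mathbb{R}^n):[u]_{s,p,\mathbb{R}^n}<\infty\}$. The space $\tilde W^{s,p}_0(\Omega)$ is the closure of $C_c^\infty(\Omega)$ (functions extended by zero) with respect to $\|u\|_{s,p,\mathbb{R}^n}=(\|u\|_{L^p(\mathbb{R}^n)}^p+[u]_{s,p,\mathbb{R}^n}^p)^{1/p}$. $\Psi(x)=e^x-\sum_{j=0}^{\lceil p-1\rceil-1}\frac{x^j}{j!}$, where $\lceil p-1\rceil$ is the smallest integer $\ge p-1$. For $sp=n$, $$\alpha^*_{s,n}=n(\gamma_{s,n})^{\frac{s}{n-s}},\qquad \gamma_{s,n}=\frac{2\omega_{n-1}^2\,\Gamma(p+1)}{n!}\sum_{k=0}^{\infty}\frac{(n+k-1)!}{k!\,(n+2k)^p},\qquad \omega_{n-1}=\frac{n\pi^{n/2}}{\Gamma(1+\frac n2)}.$$ *)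

theory Defs
  imports "HOL-Analysis.Analysis"
begin

text \<open>Real powers of extended nonnegative reals; only used with exponent \<open>a > 0\<close>,
  hence \<open>\<infinity>\<close> to the power \<open>a\<close> is \<open>\<infinity>\<close>.\<close>

definition epowr :: "ennreal \<Rightarrow> real \<Rightarrow> ennreal" where
  "epowr x a = (if x = \<infinity> then \<infinity> else ennreal (enn2real x powr a))"

definition Lp_norm :: "real \<Rightarrow> (real ^ 'n \<Rightarrow> real) \<Rightarrow> ennreal" where
  "Lp_norm p u = epowr (\<integral>\<^sup>+ x. ennreal (\<bar>u x\<bar> powr p) \<partial>lebesgue) (1 / p)"

text \<open>On the (null) diagonal the integrand is \<open>0 / 0 = 0\<close>.\<close>

definition gagliardo_seminorm :: "real \<Rightarrow> real \<Rightarrow> (real ^ 'n \<Rightarrow> real) \<Rightarrow> ennreal" where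
  "gagliardo_seminorm s p u =
     epowr (\<integral>\<^sup>+ y. (\<integral>\<^sup>+ x. ennreal (\<bar>u x - u y\<bar> powr p / norm (x - y) powr (real CARD('n) + s * p))
              \<partial>lebesgue) \<partial>lebesgue) (1 / p)"

text \<open>Elements of the function spaces are functions rather than classes modulo equality almost
  everywhere; all quantities below only depend on the class.\<close>

definition sobolev_space :: "real \<Rightarrow> real \<Rightarrow> (real ^ 'n \<Rightarrow> real) set" where
  "sobolev_space s p =
     {u. u \<in> borel_measurable lebesgue \<and> Lp_norm p u < \<infinity> \<and> gagliardo_seminorm s p u < \<infinity>}"

definition sobolev_norm :: "real \<Rightarrow> real \<Rightarrow> (real ^ 'n \<Rightarrow> real) \<Rightarrow> ennreal" where
  "sobolev_norm s p u = epowr (epowr (Lp_norm p u) p + epowr (gagliardo_seminorm s p u) p) (1 / p)"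

primrec C_diff :: "nat \<Rightarrow> (real ^ 'n \<Rightarrow> real) \<Rightarrow> bool" where
  "C_diff 0 f \<longleftrightarrow> continuous_on UNIV f"
| "C_diff (Suc k) f \<longleftrightarrow>
     (\<forall>x. f differentiable (at x)) \<and> (\<forall>v. C_diff k (\<lambda>x. frechet_derivative f (at x) v))"

definition test_functions :: "(real ^ 'n) set \<Rightarrow> (real ^ 'n \<Rightarrow> real) set" where
  "test_functions \<Omega> =
     {\<phi>. (\<forall>k. C_diff k \<phi>) \<and> compact (closure {x. \<phi> x \<noteq> 0}) \<and> closure {x. \<phi> x \<noteq> 0} \<subseteq> \<Omega>}"

definition sobolev_space_tilde0 :: "real \<Rightarrow> real \<Rightarrow> (real ^ 'n) set \<Rightarrow> (real ^ 'n \<Rightarrow> real) set" where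
  "sobolev_space_tilde0 s p \<Omega> =
     {u \<in> sobolev_space s p. \<forall>\<epsilon>>0. \<exists>\<phi>\<in>test_functions \<Omega>. sobolev_norm s p (\<lambda>x. u x - \<phi> x) < \<epsilon>}"

definition Psi :: "real \<Rightarrow> real \<Rightarrow> real" where
  "Psi p x = exp x - (\<Sum>j<nat \<lceil>p - 1\<rceil>. x ^ j / fact j)"

text \<open>Surface measure of the unit sphere in dimension \<open>n\<close>.\<close>

definition sphere_measure :: "nat \<Rightarrow> real" where
  "sphere_measure n = real n * pi powr (real n / 2) / Gamma (1 + real n / 2)"

definition gamma_const :: "real \<Rightarrow> nat \<Rightarrow> real" where
  "gamma_const s n = (let p = real n / s in
     2 * (sphere_measure n)\<^sup>2 * Gamma (p + 1) / fact n *
     (\<Sum>k. fact (n + k - 1) / (fact k * real (n + 2 * k) powr p)))"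

definition alpha_star :: "real \<Rightarrow> nat \<Rightarrow> real" where
  "alpha_star s n = real n * gamma_const s n powr (s / (real n - s))"

end

theory Submission
  imports Defs
begin

text \<open>The extremal family consists of truncated logarithms \<open>u = G (ln (R\<^sup>2 / (\<bar>x - c\<bar>\<^sup>2 + \<epsilon>\<^sup>2)) / 2)\<close>
  with \<open>G t = t * exp (- 1 / t)\<close>, which are test functions. Since \<open>s * p = n\<close>, the Gagliardo kernel
  \<open>\<bar>x - y\<bar> ^ (- 2 n)\<close> is the Jacobian of the inversion about \<open>x\<close>. Inverted balls are balls, so the
  measure of \<open>{y. \<bar>ln (\<bar>y\<bar> / \<bar>x\<bar>)\<bar> \<ge> t}\<close> with respect to this kernel is explicit, namely
  \<open>2 V \<bar>x\<bar> ^ (- n) (2 sinh t) ^ (- n)\<close> with \<open>V\<close> the volume of the unit ball. The layer cake formula and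
  the binomial series turn the integral of \<open>\<bar>ln (\<bar>y\<bar> / \<bar>x\<bar>)\<bar> powr p\<close> into the series defining
  \<open>gamma_const\<close>, and integrating over the annulus \<open>\<epsilon> \<le> \<bar>x\<bar> \<le> R\<close> shows that the \<open>p\<close>-th power of the
  seminorm of \<open>u\<close> is at most \<open>gamma_const * L + C\<close> with \<open>L = ln (R / \<epsilon>)\<close>. On the ball of radius \<open>\<epsilon>\<close>
  one has \<open>u \<ge> L - 2\<close>, so after normalisation the exponent there is at least \<open>n L - K\<close>. This exactly
  compensates the volume of that ball, and the factor \<open>f\<close> makes the integrals unbounded.\<close>

section \<open>The kernel and sphere inversion\<close>

text \<open>The error in the seminorm bound has to be additive. The exponential on the core must
  compensate \<open>\<epsilon> ^ n\<close> up to a bounded factor, because \<open>f\<close> may grow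
  arbitrarily slowly. After division by \<open>gamma_const * L + C\<close> the relative defect is of
  order \<open>1 / L\<close>, so the exponent loses only a bounded amount; an error that is merely
  \<open>o(L)\<close> would not do. The obstacle is that the inner integral is of order
  \<open>norm x\<close> to the power \<open>- n\<close>, which diverges logarithmically both at the
  centre and at infinity, where the functions are flat or zero. There the increments gain a factor
  \<open>(norm x / \<epsilon>) powr (1 / 2)\<close> or \<open>(R / norm x) powr (1 / 2)\<close> at
  the price of \<open>exp (\<tau> / 2)\<close> with
  \<open>\<tau> = \<bar>ln (norm y / norm x)\<bar>\<close>. The price is affordable, since the
  kernel tail decays like \<open>exp (- n * \<tau>)\<close> and \<open>n \<ge> 1 > 1 / 2\<close>;
  integrability for small \<open>\<tau>\<close> needs \<open>n < p\<close>, which is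
  \<open>s < 1\<close>. The p-th powers of the Lebesgue norms stay bounded too, so the penalty
  \<open>l * C'\<close> merely enlarges the additive constant and one family serves both
  suprema.\<close>

lemma has_derivative_sphere_inversion:
  fixes x y :: "real ^ 'n"
  assumes "y \<noteq> x"
  shows "((\<lambda>y. (1 / (norm (y - x))\<^sup>2) *\<^sub>R (y - x)) has_derivative
    (\<lambda>h. (1 / (norm (y - x))\<^sup>2) *\<^sub>R (h - (2 * (h \<bullet> (y - x)) / (norm (y - x))\<^sup>2) *\<^sub>R (y - x)))) (at y)"
proof -
  have *: "((\<lambda>z. (1 / (norm z)\<^sup>2) *\<^sub>R z) has_derivative
      (\<lambda>h. (1 / (norm e)\<^sup>2) *\<^sub>R (h - (2 * (h \<bullet> e) / (norm e)\<^sup>2) *\<^sub>R e))) (at e)"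
    if "e \<noteq> 0" for e :: "real ^ 'n"
  proof -
    have nz: "e \<bullet> e \<noteq> 0" using that by simp
    show ?thesis
      unfolding power2_norm_eq_inner
      by (rule derivative_eq_intros refl nz | (simp; fail))+
         (simp add: fun_eq_iff inner_commute scaleR_diff_right nz divide_simps power2_eq_square)
  qed
  have "((\<lambda>y. y - x) has_derivative (\<lambda>h. h)) (at y)"
    by (auto intro!: derivative_eq_intros)
  from has_derivative_compose[OF this *[of "y - x"]] assms show ?thesis by simp
qed

lemma orthogonal_transformation_reflection:
  fixes e :: "real ^ 'n"
  assumes "e \<noteq> 0"
  shows "orthogonal_transformation (\<lambda>h. h - (2 * (h \<bullet> e) / (norm e)\<^sup>2) *\<^sub>R e)"
proof -
  have "linear (\<lambda>h. h - (2 * (h \<bullet> e) / (norm e)\<^sup>2) *\<^sub>R e)"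
    by (rule linearI) (simp_all add: inner_left_distrib algebra_simps add_divide_distrib)
  then show ?thesis
    using assms unfolding orthogonal_transformation_def
    by (auto simp: inner_simps inner_commute field_simps power2_norm_eq_inner)
qed

text \<open>The derivative is a scalar times the reflection in the hyperplane orthogonal to
  \<open>y - x\<close>. The reflection has determinant of absolute value one, so only the
  \<open>n\<close>-th power of the scalar remains: this is the Gagliardo kernel for
  \<open>s * p = n\<close>.\<close>

lemma abs_det_sphere_inversion:
  fixes x y :: "real ^ 'n"
  assumes "y \<noteq> x"
  shows "\<bar>det (matrix (\<lambda>h. (1 / (norm (y - x))\<^sup>2) *\<^sub>R
     (h - (2 * (h \<bullet> (y - x)) / (norm (y - x))\<^sup>2) *\<^sub>R (y - x))))\<bar> = 1 / norm (x - y) ^ (2 * CARD('n))"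
proof -
  let ?T = "\<lambda>h. h - (2 * (h \<bullet> (y - x)) / (norm (y - x))\<^sup>2) *\<^sub>R (y - x)"
  have T: "orthogonal_transformation ?T"
    using orthogonal_transformation_reflection[of "y - x"] assms by simp
  have "matrix (\<lambda>h. (1 / (norm (y - x))\<^sup>2) *\<^sub>R ?T h) = matrix ((*\<^sub>R) (1 / (norm (y - x))\<^sup>2)) ** matrix ?T"
    using matrix_compose[of ?T "(*\<^sub>R) (1 / (norm (y - x))\<^sup>2)"] T
    by (simp add: o_def orthogonal_transformation_linear linear_scaleR)
  then show ?thesis
    using orthogonal_transformation_det[OF T]
    by (simp add: det_mul abs_mult det_matrix_scaleR power_mult norm_minus_commute power_one_over)
qed

text \<open>Membership of a point and of its image are both sign conditions on the polynomial
  \<open>D * q + 2 * (x \<bullet> z) + 1\<close>, divided by \<open>q > 0\<close> in one case and by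
  \<open>D\<close> in the other. The region is always the side of the sphere that does not contain
  \<open>x\<close>, so its image is bounded; for the exterior region the removed point 0 is the
  image of infinity.\<close>

lemma sphere_inversion_image:
  fixes x :: "real ^ 'n"
  assumes rho: "0 \<le> \<rho>" "\<rho> \<noteq> norm x"
  shows "(\<lambda>y. (1 / (norm (y - x))\<^sup>2) *\<^sub>R (y - x)) `
      {y. y \<noteq> x \<and> (if \<rho> < norm x then norm y \<le> \<rho> else \<rho> \<le> norm y)}
    = cball (- (1 / ((norm x)\<^sup>2 - \<rho>\<^sup>2)) *\<^sub>R x) (\<rho> / \<bar>(norm x)\<^sup>2 - \<rho>\<^sup>2\<bar>) - {0}"
proof -
  define D where "D = (norm x)\<^sup>2 - \<rho>\<^sup>2"
  define I where "I = (\<lambda>z::real^'n. (1 / (norm z)\<^sup>2) *\<^sub>R z)"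
  have pos: "0 < norm x + \<rho>" using rho norm_ge_zero[of x] by linarith
  have Dm: "D = (norm x - \<rho>) * (norm x + \<rho>)"
    unfolding D_def by (simp add: power2_eq_square algebra_simps)
  have D: "D \<noteq> 0" "(D > 0) = (\<rho> < norm x)"
    unfolding Dm using rho pos by (simp_all add: zero_less_mult_iff)
  \<comment> \<open>Division by zero gives \<open>I 0 = 0\<close>, so \<open>I\<close> is an
    involution of the whole space and images are computed by solving
    \<open>y = x + I z\<close>.\<close>
  have II: "I (I z) = z" for z by (cases "z = 0") (simp_all add: I_def power2_eq_square)
  have I0: "I z = 0 \<longleftrightarrow> z = 0" for z by (simp add: I_def)
  have key: "(if \<rho> < norm x then norm (x + I z) \<le> \<rho> else \<rho> \<le> norm (x + I z)) \<longleftrightarrow>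
      z \<in> cball (- (1 / D) *\<^sub>R x) (\<rho> / \<bar>D\<bar>)" if z: "z \<noteq> 0" for z
  proof -
    define q where "q = (norm z)\<^sup>2"
    have q: "q > 0" using z by (simp add: q_def)
    have e1: "(norm (x + I z))\<^sup>2 - \<rho>\<^sup>2 = (D * q + 2 * (x \<bullet> z) + 1) / q"
      using q unfolding I_def D_def q_def power2_norm_eq_inner
      by (simp add: inner_simps inner_commute field_simps power2_eq_square)
    have e2: "(norm (z + (1 / D) *\<^sub>R x))\<^sup>2 - (\<rho> / \<bar>D\<bar>)\<^sup>2 = (D * q + 2 * (x \<bullet> z) + 1) / D"
    proof -
      have "(norm (z + (1 / D) *\<^sub>R x))\<^sup>2 = q + 2 * (x \<bullet> z) / D + (norm x)\<^sup>2 / D\<^sup>2"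
        unfolding q_def power2_norm_eq_inner
        by (simp add: inner_simps inner_commute field_simps power2_eq_square)
      moreover have "(\<rho> / \<bar>D\<bar>)\<^sup>2 = \<rho>\<^sup>2 / D\<^sup>2" by (simp add: power_divide)
      moreover have "(norm x)\<^sup>2 / D\<^sup>2 - \<rho>\<^sup>2 / D\<^sup>2 = 1 / D"
      proof -
        have "(norm x)\<^sup>2 / D\<^sup>2 - \<rho>\<^sup>2 / D\<^sup>2 = D / D\<^sup>2" unfolding D_def by (simp add: diff_divide_distrib)
        then show ?thesis by (simp add: power2_eq_square)
      qed
      moreover have "(D * q + 2 * (x \<bullet> z) + 1) / D = q + 2 * (x \<bullet> z) / D + 1 / D"
        using D(1) by (simp add: add_divide_distrib)
      ultimately show ?thesis by linarith
    qed
    have "z \<in> cball (- (1 / D) *\<^sub>R x) (\<rho> / \<bar>D\<bar>) \<longleftrightarrow> (norm (z + (1 / D) *\<^sub>R x))\<^sup>2 - (\<rho> / \<bar>D\<bar>)\<^sup>2 \<le> 0"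
    proof -
      have "dist (- (1 / D) *\<^sub>R x) z = norm (z + (1 / D) *\<^sub>R x)"
        by (metis (no_types, lifting) dist_norm dist_commute diff_minus_eq_add scaleR_minus_left)
      then show ?thesis using rho by (simp add: power_mono_iff)
    qed
    also have "\<dots> \<longleftrightarrow> (if \<rho> < norm x then D * q + 2 * (x \<bullet> z) + 1 \<le> 0 else D * q + 2 * (x \<bullet> z) + 1 \<ge> 0)"
      using D unfolding e2 by (auto simp: divide_le_0_iff)
    also have "\<dots> \<longleftrightarrow> (if \<rho> < norm x then (norm (x + I z))\<^sup>2 - \<rho>\<^sup>2 \<le> 0 else (norm (x + I z))\<^sup>2 - \<rho>\<^sup>2 \<ge> 0)"
      using q unfolding e1 by (simp add: divide_le_0_iff zero_le_divide_iff)
    also have "\<dots> \<longleftrightarrow> (if \<rho> < norm x then norm (x + I z) \<le> \<rho> else \<rho> \<le> norm (x + I z))"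
      using rho by (simp add: power_mono_iff)
    finally show ?thesis by simp
  qed
  show ?thesis (is "?J ` ?A = ?B")
  proof -
    have J: "?J y = I (y - x)" for y by (simp add: I_def)
    have "z \<in> ?J ` ?A \<longleftrightarrow> z \<in> ?B" for z
    proof
      assume "z \<in> ?J ` ?A"
      then obtain y where y: "y \<in> ?A" "z = I (y - x)" unfolding J by auto
      then have "y = x + I z" "z \<noteq> 0" using II[of "y - x"] I0 by auto
      then show "z \<in> ?B" using key[of z] y(1) unfolding D_def by auto
    next
      assume "z \<in> ?B"
      then have "z \<noteq> 0" "x + I z \<in> ?A" using key[of z] I0 unfolding D_def by auto
      moreover have "z = ?J (x + I z)" unfolding J by (simp add: II)
      ultimately show "z \<in> ?J ` ?A" by blast
    qed
    then show ?thesis by blast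
  qed
qed

lemma nn_integral_inversion_kernel_wellorder:
  fixes x :: "real ^ 'm::{finite,wellorder}"
  assumes rho: "0 \<le> \<rho>" "\<rho> \<noteq> norm x"
  shows "(\<integral>\<^sup>+y. ennreal (indicator {y. if \<rho> < norm x then norm y \<le> \<rho> else \<rho> \<le> norm y} y
      * (1 / norm (x - y) ^ (2 * CARD('m)))) \<partial>lborel)
    = ennreal (unit_ball_vol (real CARD('m)) * (\<rho> / \<bar>(norm x)\<^sup>2 - \<rho>\<^sup>2\<bar>) ^ CARD('m))"
proof -
  define S where "S = {y. y \<noteq> x \<and> (if \<rho> < norm x then norm y \<le> \<rho> else \<rho> \<le> norm y)}"
  define J where "J = (\<lambda>y. (1 / (norm (y - x))\<^sup>2) *\<^sub>R (y - x))"
  define J' where "J' = (\<lambda>y h. (1 / (norm (y - x))\<^sup>2) *\<^sub>R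
     (h - (2 * (h \<bullet> (y - x)) / (norm (y - x))\<^sup>2) *\<^sub>R (y - x)))"
  let ?B = "cball (- (1 / ((norm x)\<^sup>2 - \<rho>\<^sup>2)) *\<^sub>R x) (\<rho> / \<bar>(norm x)\<^sup>2 - \<rho>\<^sup>2\<bar>)"
  have "S \<in> sets borel" unfolding S_def by measurable
  then have S: "S \<in> sets lebesgue" by simp
  have der: "(J has_derivative J' y) (at y within S)" if "y \<in> S" for y
  proof -
    have "y \<noteq> x" using that by (simp add: S_def)
    then show ?thesis
      unfolding J_def J'_def by (rule has_derivative_at_withinI[OF has_derivative_sphere_inversion])
  qed
  have inj: "inj_on J S"
  proof (rule inj_onI)
    fix y z assume yz: "y \<in> S" "z \<in> S" "J y = J z"
    have "(1 / (norm (J y))\<^sup>2) *\<^sub>R J y = y - x" if "y \<in> S" for y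
    proof -
      have "norm (y - x) \<noteq> 0" using that by (simp add: S_def)
      then show ?thesis unfolding J_def by (simp add: power2_eq_square)
    qed
    then have "y - x = z - x" using yz by metis
    then show "y = z" by simp
  qed
  have img: "J ` S = ?B - {0}"
    unfolding J_def S_def by (rule sphere_inversion_image[OF rho])
  have measure: "measure lebesgue (?B - {0}) = measure lebesgue ?B"
    by (rule measure_negligible_symdiff) (auto intro: negligible_subset[of "{0}"])
  have m: "J ` S \<in> lmeasurable \<and> measure lebesgue (J ` S)
      = unit_ball_vol (real CARD('m)) * (\<rho> / \<bar>(norm x)\<^sup>2 - \<rho>\<^sup>2\<bar>) ^ CARD('m)"
  proof -
    have "?B - {0} \<in> lmeasurable"
      by (intro fmeasurable.Diff lmeasurable_cball lmeasurable_compact) auto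
    then show ?thesis
      using measure rho unfolding img by (simp add: content_cball)
  qed
  have "((\<lambda>y. \<bar>det (matrix (J' y))\<bar>) has_integral
      unit_ball_vol (real CARD('m)) * (\<rho> / \<bar>(norm x)\<^sup>2 - \<rho>\<^sup>2\<bar>) ^ CARD('m)) S"
    using has_measure_differentiable_image[OF S der inj] m by blast
  then have "((\<lambda>y. 1 / norm (x - y) ^ (2 * CARD('m))) has_integral
      unit_ball_vol (real CARD('m)) * (\<rho> / \<bar>(norm x)\<^sup>2 - \<rho>\<^sup>2\<bar>) ^ CARD('m)) S"
    by (rule has_integral_eq[rotated]) (simp add: J'_def S_def abs_det_sphere_inversion)
  from nn_integral_has_integral_lebesgue[OF _ this]
  have "(\<integral>\<^sup>+y. ennreal (indicator S y * (1 / norm (x - y) ^ (2 * CARD('m)))) \<partial>lborel) =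
      ennreal (unit_ball_vol (real CARD('m)) * (\<rho> / \<bar>(norm x)\<^sup>2 - \<rho>\<^sup>2\<bar>) ^ CARD('m))" by simp
  \<comment> \<open>The centre \<open>y = x\<close> makes no difference, since the kernel takes the
    value \<open>1 / 0 = 0\<close> there.\<close>
  also have "(\<integral>\<^sup>+y. ennreal (indicator S y * (1 / norm (x - y) ^ (2 * CARD('m)))) \<partial>lborel) =
     (\<integral>\<^sup>+y. ennreal (indicator {y. if \<rho> < norm x then norm y \<le> \<rho> else \<rho> \<le> norm y} y
      * (1 / norm (x - y) ^ (2 * CARD('m)))) \<partial>lborel)"
    by (intro nn_integral_cong) (auto simp: S_def indicator_def)
  finally show ?thesis .
qed

text \<open>The change of variables theorem of the library requires a well-ordered index type; every
  finite type can be given such an order on an isomorphic copy.\<close>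

datatype 'n ordered_copy = Ordered_Copy (original: 'n)

lemma bij_Ordered_Copy: "bij Ordered_Copy"
  by (rule bij_betw_byWitness[where f' = original]) auto

instance ordered_copy :: (finite) finite
proof
  show "finite (UNIV :: 'a ordered_copy set)"
    using bij_betw_finite[OF bij_Ordered_Copy[where 'a='a]] by simp
qed

instantiation ordered_copy :: (finite) wellorder
begin
definition less_eq_ordered_copy :: "'a ordered_copy \<Rightarrow> 'a ordered_copy \<Rightarrow> bool" where
  "a \<le> b \<longleftrightarrow> to_nat (original a) \<le> to_nat (original b)"
definition less_ordered_copy :: "'a ordered_copy \<Rightarrow> 'a ordered_copy \<Rightarrow> bool" where
  "a < b \<longleftrightarrow> to_nat (original a) < to_nat (original b)"
instance
proof
  fix P :: "'a ordered_copy \<Rightarrow> bool" and a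
  assume step: "\<And>x. (\<And>y. y < x \<Longrightarrow> P y) \<Longrightarrow> P x"
  show "P a"
  proof (induction a rule: measure_induct_rule[where f = "\<lambda>a. to_nat (original a)"])
    case (less x)
    show ?case by (rule step, rule less) (simp add: less_ordered_copy_def)
  qed
qed (auto simp: less_eq_ordered_copy_def less_ordered_copy_def ordered_copy.expand)
end

text \<open>Relabelling coordinates pulls a box back to a box with the same side lengths, and
  Lebesgue measure is determined by its values on boxes.\<close>

lemma distr_lborel_reindex:
  "distr lborel borel (\<lambda>v :: real ^ 'n ordered_copy. \<chi> i::'n::finite. v $ Ordered_Copy i) = lborel"
proof -
  let ?F = "\<lambda>v :: real ^ 'n ordered_copy. \<chi> i::'n. v $ Ordered_Copy i"
  let ?G = "\<lambda>v :: real ^ 'n. \<chi> i. v $ original i"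
  have [measurable]: "?F \<in> borel_measurable borel"
    by (intro borel_measurable_continuous_onI continuous_intros)
  have prod: "(\<Prod>b\<in>(Basis :: (real ^ 'k::finite) set). v \<bullet> b) = (\<Prod>i\<in>UNIV. v $ i)" for v :: "real ^ 'k"
  proof -
    have B: "(Basis :: (real ^ 'k::finite) set) = range (\<lambda>i. axis i 1)"
      by (auto simp: Basis_vec_def)
    show ?thesis unfolding B
      by (subst prod.reindex) (auto simp: inj_on_def axis_eq_axis inner_axis)
  qed
  have "lborel = distr lborel borel ?F"
  proof (rule lborel_eqI)
    fix l u :: "real ^ 'n" assume le: "\<And>b. b \<in> Basis \<Longrightarrow> l \<bullet> b \<le> u \<bullet> b"
    then have le': "l $ i \<le> u $ i" for i
      by (metis axis_in_Basis_iff inner_axis inner_real_def mult.right_neutral real_inner_1_right singletonI Basis_real_def)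
    have "?F -` box l u = box (?G l) (?G u)"
      unfolding mem_box_cart set_eq_iff vimage_eq 
      by (auto dest: spec[where x = "Ordered_Copy _"]) (metis ordered_copy.collapse ordered_copy.sel)+
    then have "emeasure (distr lborel borel ?F) (box l u) = emeasure lborel (box (?G l) (?G u))"
      by (simp add: emeasure_distr)
    also have "\<dots> = ennreal (\<Prod>b\<in>Basis. (?G u - ?G l) \<bullet> b)"
      using le' by (intro emeasure_lborel_box) (auto simp: Basis_vec_def inner_axis)
    also have "(\<Prod>b\<in>Basis. (?G u - ?G l) \<bullet> b) = (\<Prod>i\<in>UNIV. (u - l) $ original i)"
      unfolding prod by simp
    also have "\<dots> = (\<Prod>i\<in>UNIV. (u - l) $ i)"
      using prod.reindex_bij_betw[OF bij_Ordered_Copy[where 'a='n], of "\<lambda>i. (u - l) $ original i"] by simp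
    finally show "emeasure (distr lborel borel ?F) (box l u) = ennreal (\<Prod>b\<in>Basis. (u - l) \<bullet> b)"
      unfolding prod .
  qed simp
  then show ?thesis by simp
qed

lemma nn_integral_inversion_kernel:
  fixes x :: "real ^ 'n"
  assumes rho: "0 \<le> \<rho>" "\<rho> \<noteq> norm x"
  shows "(\<integral>\<^sup>+y. ennreal (indicator {y. if \<rho> < norm x then norm y \<le> \<rho> else \<rho> \<le> norm y} y
      * (1 / norm (x - y) ^ (2 * CARD('n)))) \<partial>lborel)
    = ennreal (unit_ball_vol (real CARD('n)) * (\<rho> / \<bar>(norm x)\<^sup>2 - \<rho>\<^sup>2\<bar>) ^ CARD('n))"
proof -
  let ?F = "\<lambda>v :: real ^ 'n ordered_copy. \<chi> i::'n. v $ Ordered_Copy i"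
  let ?G = "\<lambda>v :: real ^ 'n. \<chi> i. v $ original i"
  have [measurable]: "?F \<in> borel_measurable borel"
    by (intro borel_measurable_continuous_onI continuous_intros)
  have nF: "norm (?F v) = norm v" for v
    using sum.reindex_bij_betw[OF bij_Ordered_Copy[where 'a='n], of "\<lambda>i. (v $ i)\<^sup>2"]
    by (simp add: norm_vec_def L2_set_def)
  have FG: "?F (?G x) = x" by (simp add: vec_eq_iff)
  have nd: "norm (x - ?F v) = norm (?G x - v)" for v
    by (subst FG[symmetric], subst nF[symmetric], rule arg_cong[of _ _ norm]) (simp add: vec_eq_iff)
  have nG: "norm (?G x) = norm x" using nF[of "?G x"] FG by simp
  have card: "CARD('n ordered_copy) = CARD('n)"
    using bij_betw_same_card[OF bij_Ordered_Copy[where 'a='n]] by simp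
  show ?thesis
  proof -
    let ?k = "\<lambda>y. ennreal (indicator {y. if \<rho> < norm x then norm y \<le> \<rho> else \<rho> \<le> norm y} y
      * (1 / norm (x - y) ^ (2 * CARD('n))))"
    have [measurable]: "?k \<in> borel_measurable borel" by measurable
    have "(\<integral>\<^sup>+y. ?k y \<partial>lborel) = (\<integral>\<^sup>+y. ?k y \<partial>distr lborel borel ?F)"
      unfolding distr_lborel_reindex ..
    also have "\<dots> = (\<integral>\<^sup>+v. ?k (?F v) \<partial>lborel)"
      by (rule nn_integral_distr) auto
    also have "\<dots> = ennreal (unit_ball_vol (real CARD('n)) * (\<rho> / \<bar>(norm x)\<^sup>2 - \<rho>\<^sup>2\<bar>) ^ CARD('n))"
      using nn_integral_inversion_kernel_wellorder[of \<rho> "?G x"] rho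
      unfolding nd indicator_def mem_Collect_eq nF nG card by simp
    finally show ?thesis .
  qed
qed

section \<open>The series for the constant\<close>

lemma nn_integral_powr_exp:
  assumes "0 < a" "0 < c"
  shows "(\<integral>\<^sup>+t. ennreal (if 0 < t then t powr (a - 1) * exp (- (c * t)) else 0) \<partial>lborel)
    = ennreal (Gamma a / c powr a)"
proof -
  let ?f = "\<lambda>t::real. ennreal (indicator {0..} t * t powr (a - 1) / exp t)"
  let ?I = "\<integral>\<^sup>+t. ennreal (if 0 < t then t powr (a - 1) * exp (- (c * t)) else 0) \<partial>lborel"
  have "ennreal (Gamma a) = (\<integral>\<^sup>+t. ?f t \<partial>lborel)"
    by (rule Gamma_conv_nn_integral_real[OF assms(1)])
  also have "\<dots> = ennreal c * (\<integral>\<^sup>+t. ?f (c * t) \<partial>lborel)"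
    using nn_integral_real_affine[of ?f c 0] assms by simp
  also have "(\<integral>\<^sup>+t. ?f (c * t) \<partial>lborel) =
      (\<integral>\<^sup>+t. ennreal (c powr (a - 1)) * ennreal (if 0 < t then t powr (a - 1) * exp (- (c * t)) else 0) \<partial>lborel)"
    using assms
    by (intro nn_integral_cong)
       (auto simp: indicator_def powr_mult ennreal_mult[symmetric] exp_minus field_simps zero_le_mult_iff)
  also have "\<dots> = ennreal (c powr (a - 1)) * ?I"
    by (rule nn_integral_cmult) measurable
  finally have "ennreal (Gamma a) = ennreal (c powr a) * ?I"
    using assms by (simp add: mult.assoc[symmetric] ennreal_mult[symmetric] powr_diff)
  then have "ennreal (1 / c powr a) * ennreal (Gamma a) = (ennreal (1 / c powr a) * ennreal (c powr a)) * ?I"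
    by (simp only: mult.assoc)
  also have "ennreal (1 / c powr a) * ennreal (c powr a) = 1"
    using assms by (simp add: ennreal_mult[symmetric])
  finally show ?thesis
    using assms by (simp add: ennreal_mult[symmetric] Gamma_real_pos less_imp_le mult.commute)
qed

text \<open>With \<open>z = exp (- (2 * t))\<close> one has
  \<open>exp t - exp (- t) = exp t * (1 - z)\<close>, so this is the negative binomial series of
  \<open>(1 - z) powr (- n)\<close>. The rates \<open>n + 2 * k\<close> become the denominators in
  \<open>gamma_const\<close>.\<close>

lemma sums_power_inverse_two_sinh:
  assumes t: "0 < (t::real)" and n: "0 < n"
  shows "(\<lambda>k. fact (n + k - 1) / (fact k * fact (n - 1)) * exp (- (real (n + 2 * k) * t)))
    sums ((1 / (exp t - exp (- t))) ^ n)"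
proof -
  define z where "z = exp (- (2 * t))"
  have z: "0 < z" "z < 1" using t by (auto simp: z_def)
  have "(\<lambda>k. ((- real n) gchoose k) * (- z) ^ k) sums (1 + - z) powr (- real n)"
    using z by (intro gen_binomial_real) auto
  \<comment> \<open>The sign from negating the upper index of the binomial coefficient cancels the
    sign of \<open>(- z) ^ k\<close>, so all terms are positive.\<close>
  moreover have "((- real n) gchoose k) * (- z) ^ k = fact (n + k - 1) / (fact k * fact (n - 1)) * z ^ k" for k
  proof -
    have "((- real n) gchoose k) = (- 1) ^ k * (real (n + k - 1) gchoose k)"
      using n by (subst gbinomial_minus) (simp add: of_nat_diff)
    also have "real (n + k - 1) gchoose k = real ((n + k - 1) choose k)"
      by (simp add: binomial_gbinomial)
    also have "real ((n + k - 1) choose k) = fact (n + k - 1) / (fact k * fact (n - 1))"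
      using n by (subst binomial_fact) (auto simp: algebra_simps)
    finally have "((- real n) gchoose k) * (- z) ^ k =
        ((- 1) ^ k * (- 1) ^ k) * (fact (n + k - 1) / (fact k * fact (n - 1)) * z ^ k)"
      by (subst power_minus) simp
    then show ?thesis by (simp add: power_add[symmetric] mult_2[symmetric])
  qed
  ultimately have "(\<lambda>k. fact (n + k - 1) / (fact k * fact (n - 1)) * z ^ k) sums (1 - z) powr (- real n)"
    by simp
  from sums_mult[OF this, of "exp (- (real n * t))"]
  have "(\<lambda>k. fact (n + k - 1) / (fact k * fact (n - 1)) * exp (- (real (n + 2 * k) * t)))
    sums (exp (- (real n * t)) * (1 - z) powr (- real n))"
    by (rule sums_cong[THEN iffD1, rotated])
       (simp add: z_def exp_of_nat_mult[symmetric] exp_add[symmetric] mult_exp_exp algebra_simps)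
  also have "exp (- (real n * t)) * (1 - z) powr (- real n) = (1 / (exp t - exp (- t))) ^ n"
  proof -
    have e: "1 - z = exp (- t) * (exp t - exp (- t))"
      by (simp add: z_def algebra_simps mult_exp_exp)
    have "(1 - z) powr (- real n) = 1 / (1 - z) ^ n"
      using z by (simp add: powr_minus powr_realpow divide_inverse)
    moreover have "exp (- (real n * t)) = exp (- t) ^ n"
      by (simp add: exp_of_nat_mult[symmetric])
    ultimately show ?thesis by (simp add: e power_mult_distrib power_one_over)
  qed
  finally show ?thesis .
qed

text \<open>Each term of the series integrates to a Gamma value, and
  \<open>p * Gamma p = Gamma (p + 1)\<close>. Since all terms are nonnegative, integration term by
  term is legitimate before convergence is known; hence the sum is taken in the extended
  reals.\<close>

lemma nn_integral_powr_two_sinh: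
  assumes p: "0 < p" and n: "0 < n"
  shows "(\<integral>\<^sup>+t. ennreal (if 0 < t then p * t powr (p - 1) * (1 / (exp t - exp (- t))) ^ n else 0) \<partial>lborel)
    = (\<Sum>k. ennreal (Gamma (p + 1) / fact (n - 1) * (fact (n + k - 1) / (fact k * real (n + 2 * k) powr p))))"
proof -
  let ?c = "\<lambda>k. fact (n + k - 1) / (fact k * fact (n - 1)) :: real"
  let ?g = "\<lambda>k t. ennreal (p * ?c k) * ennreal (if 0 < t then t powr (p - 1) * exp (- (real (n + 2 * k) * t)) else 0)"
  have eq: "ennreal (if 0 < t then p * t powr (p - 1) * (1 / (exp t - exp (- t))) ^ n else 0) = (\<Sum>k. ?g k t)" for t :: real
  proof (cases "0 < t")
    case True
    have "(\<lambda>k. p * t powr (p - 1) * (?c k * exp (- (real (n + 2 * k) * t)))) sums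
        (p * t powr (p - 1) * (1 / (exp t - exp (- t))) ^ n)"
      by (intro sums_mult sums_power_inverse_two_sinh True n)
    then have "(\<Sum>k. ennreal (p * t powr (p - 1) * (?c k * exp (- (real (n + 2 * k) * t))))) =
        ennreal (p * t powr (p - 1) * (1 / (exp t - exp (- t))) ^ n)"
      using p by (intro suminf_ennreal_eq) auto
    moreover have "ennreal (p * t powr (p - 1) * (?c k * exp (- (real (n + 2 * k) * t)))) = ?g k t" for k
      using True p by (simp add: ennreal_mult[symmetric] mult_ac)
    ultimately show ?thesis using True by simp
  qed simp
  have "(\<integral>\<^sup>+t. ennreal (if 0 < t then p * t powr (p - 1) * (1 / (exp t - exp (- t))) ^ n else 0) \<partial>lborel)
      = (\<integral>\<^sup>+t. (\<Sum>k. ?g k t) \<partial>lborel)"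
    by (intro nn_integral_cong eq)
  also have "\<dots> = (\<Sum>k. \<integral>\<^sup>+t. ?g k t \<partial>lborel)"
    by (intro nn_integral_suminf) measurable
  also have "(\<lambda>k. \<integral>\<^sup>+t. ?g k t \<partial>lborel) =
      (\<lambda>k. ennreal (Gamma (p + 1) / fact (n - 1) * (fact (n + k - 1) / (fact k * real (n + 2 * k) powr p))))"
  proof
    fix k
    have "(\<integral>\<^sup>+t. ?g k t \<partial>lborel) = ennreal (p * ?c k) * ennreal (Gamma p / real (n + 2 * k) powr p)"
      using p n by (subst nn_integral_cmult) (auto simp: nn_integral_powr_exp simp del: of_nat_add)
    also have "\<dots> = ennreal (p * ?c k * (Gamma p / real (n + 2 * k) powr p))"
      using p by (subst ennreal_mult) (auto simp: Gamma_real_pos less_imp_le)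
    also have "p * ?c k * (Gamma p / real (n + 2 * k) powr p) =
        Gamma (p + 1) / fact (n - 1) * (fact (n + k - 1) / (fact k * real (n + 2 * k) powr p))"
    proof -
      have "Gamma (p + 1) = p * Gamma p"
        using p by (intro Gamma_plus1) (auto dest: nonpos_Ints_nonpos)
      then show ?thesis by (simp add: mult_ac)
    qed
    finally show "(\<integral>\<^sup>+t. ?g k t \<partial>lborel) =
        ennreal (Gamma (p + 1) / fact (n - 1) * (fact (n + k - 1) / (fact k * real (n + 2 * k) powr p)))" .
  qed
  finally show ?thesis .
qed

text \<open>The factor \<open>1 / t\<close> carries the singularity at 0. The rate
  \<open>3 / 4\<close> is a compromise: below the true rate 1, but above the rate
  \<open>1 / 2\<close> of the weight \<open>exp (t / 2)\<close>, which therefore stays affordable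
  even in dimension one.\<close>

lemma inverse_two_sinh_le:
  assumes "0 < (t::real)"
  shows "1 / (exp t - exp (- t)) \<le> 4 * exp (- (3 / 4 * t)) / t"
proof -
  have "exp (t / 4) \<ge> 1 + t / 4" by (rule exp_ge_add_one_self)
  have "exp (2 * t) \<ge> 1 + 2 * t" by (rule exp_ge_add_one_self)
  moreover have "exp (2 * t) = exp t * exp t" "exp t * exp (-t) = 1" by (simp_all add: mult_exp_exp)
  ultimately have "(1 + 2 * t) * (exp t - exp (- t)) \<ge> 2 * t * exp t"
  proof -
    assume a: "exp (2 * t) \<ge> 1 + 2 * t" "exp (2 * t) = exp t * exp t" "exp t * exp (-t) = 1"
    have "exp t \<ge> (1 + 2 * t) * exp (- t)"
    proof -
      have "(1 + 2 * t) * exp (- t) \<le> (exp t * exp t) * exp (- t)"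
        using a by (intro mult_right_mono) auto
      then show ?thesis using a(3) by (simp add: mult.assoc)
    qed
    then show ?thesis by (simp add: algebra_simps)
  qed
  moreover have "exp (t / 4) * 8 \<ge> 1 + 2 * t" using \<open>exp (t / 4) \<ge> 1 + t / 4\<close> by linarith
  moreover have pos: "exp t - exp (- t) > 0" using assms by simp
  ultimately have "2 * t * exp t \<le> (exp (t / 4) * 8) * (exp t - exp (- t))"
    by (meson less_imp_le mult_right_mono order_trans)
  moreover have "exp t = exp (t / 4) * exp (3 / 4 * t)" by (simp add: mult_exp_exp)
  ultimately have "exp (t / 4) * (t * exp (3 / 4 * t)) \<le> exp (t / 4) * (4 * (exp t - exp (- t)))"
    by (simp add: algebra_simps)
  then have "t * exp (3 / 4 * t) \<le> 4 * (exp t - exp (- t))" by simp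
  then have "1 / (exp t - exp (- t)) \<le> 4 / (t * exp (3 / 4 * t))"
    using pos assms by (simp add: field_simps)
  also have "\<dots> = 4 * exp (- (3 / 4 * t)) / t" by (simp add: exp_minus field_simps)
  finally show ?thesis .
qed

text \<open>The first factors are the derivative of \<open>t powr p * exp (t / 2)\<close>. Near 0
  the integrand is of order \<open>t powr (p - n - 1)\<close>, which is integrable because
  \<open>n < p\<close>; at infinity the rate \<open>1 / 4 = 3 / 4 - 1 / 2\<close> remains.\<close>

lemma nn_integral_powr_exp_two_sinh_finite:
  assumes p: "real n < p" and n: "0 < n"
  shows "(\<integral>\<^sup>+t. ennreal (if 0 < t then (p * t powr (p - 1) + t powr p / 2) * exp (t / 2)
      * (1 / (exp t - exp (- t))) ^ n else 0) \<partial>lborel) < \<infinity>"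
proof -
  let ?f = "\<lambda>a t::real. ennreal (if 0 < t then t powr (a - 1) * exp (- (1 / 4 * t)) else 0)"
  have "(\<integral>\<^sup>+t. ennreal (if 0 < t then (p * t powr (p - 1) + t powr p / 2) * exp (t / 2)
      * (1 / (exp t - exp (- t))) ^ n else 0) \<partial>lborel)
    \<le> (\<integral>\<^sup>+t. ennreal (4 ^ n * p) * ?f (p - n) t + ennreal (4 ^ n / 2) * ?f (p - n + 1) t \<partial>lborel)"
  proof (intro nn_integral_mono)
    fix t :: real
    show "ennreal (if 0 < t then (p * t powr (p - 1) + t powr p / 2) * exp (t / 2)
      * (1 / (exp t - exp (- t))) ^ n else 0) \<le> ennreal (4 ^ n * p) * ?f (p - n) t + ennreal (4 ^ n / 2) * ?f (p - n + 1) t"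
    proof (cases "0 < t")
      case t: True
      have pos: "exp t - exp (- t) > 0" using t by simp
      have "(1 / (exp t - exp (- t))) ^ n \<le> (4 * exp (- (3 / 4 * t)) / t) ^ n"
        using pos by (intro power_mono inverse_two_sinh_le t) auto
      also have "\<dots> = 4 ^ n * exp (- (3 / 4 * t)) ^ n / t ^ n"
        by (simp add: power_divide power_mult_distrib)
      \<comment> \<open>One of the \<open>n\<close> exponential factors already beats
        \<open>exp (t / 2)\<close>; the others are bounded by 1.\<close>
      also have "\<dots> \<le> 4 ^ n * exp (- (3 / 4 * t)) / t ^ n"
        using t n power_decreasing[of 1 n "exp (- (3 / 4 * t))"]
        by (intro divide_right_mono mult_left_mono) auto
      finally have "(p * t powr (p - 1) + t powr p / 2) * exp (t / 2) * (1 / (exp t - exp (- t))) ^ n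
        \<le> (p * t powr (p - 1) + t powr p / 2) * exp (t / 2) * (4 ^ n * exp (- (3 / 4 * t)) / t ^ n)"
        using p by (intro mult_left_mono) auto
      also have "\<dots> = 4 ^ n * p * (t powr (p - n - 1) * exp (- (1 / 4 * t)))
          + 4 ^ n / 2 * (t powr (p - n + 1 - 1) * exp (- (1 / 4 * t)))"
      proof -
        have "t powr (p - n - 1) = t powr (p - 1) / t ^ n" "t powr (p - n + 1 - 1) = t powr p / t ^ n"
          using t powr_diff[of t "p - 1" "real n"] powr_diff[of t p "real n"]
          by (simp_all add: powr_realpow algebra_simps)
        moreover have "exp (- (1 / 4 * t)) = exp (t / 2) * exp (- (3 / 4 * t))"
          by (simp add: mult_exp_exp)
        ultimately show ?thesis by (simp add: algebra_simps add_divide_distrib)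
      qed
      finally show ?thesis
        using t p by (simp add: ennreal_mult[symmetric] ennreal_plus[symmetric] ennreal_leI del: ennreal_plus)
    qed simp
  qed
  also have "\<dots> = ennreal (4 ^ n * p) * (\<integral>\<^sup>+t. ?f (p - n) t \<partial>lborel)
      + ennreal (4 ^ n / 2) * (\<integral>\<^sup>+t. ?f (p - n + 1) t \<partial>lborel)"
    by (subst nn_integral_add) (auto simp: nn_integral_cmult)
  also have "\<dots> < \<infinity>"
    using p by (subst (1 2) nn_integral_powr_exp) (auto simp: ennreal_mult_less_top)
  finally show ?thesis .
qed

text \<open>Write \<open>h (g y)\<close> as the integral of \<open>h'\<close> from 0 to
  \<open>g y\<close> and exchange the integrals; the density \<open>k\<close> only enters through
  the tails. Differentiability is asked on the open half-line and continuity at 0, as suits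
  \<open>powr\<close>.\<close>

lemma nn_integral_layer_cake_le:
  fixes g k :: "real ^ 'n \<Rightarrow> real" and h h' :: "real \<Rightarrow> real" and T :: "real \<Rightarrow> ennreal"
  assumes [measurable]: "g \<in> borel_measurable borel" "k \<in> borel_measurable borel"
      "h' \<in> borel_measurable borel"
    and g: "\<And>y. 0 \<le> g y"
    and cont: "continuous_on {0..} h" and h0: "h 0 = 0"
    and deriv: "\<And>t. 0 < t \<Longrightarrow> (h has_real_derivative h' t) (at t)"
    and nonneg: "\<And>t. 0 < t \<Longrightarrow> 0 \<le> h' t"
    and tail: "\<And>t. 0 < t \<Longrightarrow> (\<integral>\<^sup>+y. (if t \<le> g y then ennreal (k y) else 0) \<partial>lborel) \<le> T t"
  shows "(\<integral>\<^sup>+y. ennreal (h (g y)) * ennreal (k y) \<partial>lborel)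
    \<le> (\<integral>\<^sup>+t. (if 0 < t then ennreal (h' t) * T t else 0) \<partial>lborel)"
proof -
  have h: "ennreal (h \<tau>) = (\<integral>\<^sup>+t. (if 0 < t \<and> t \<le> \<tau> then ennreal (h' t) else 0) \<partial>lborel)" if "0 \<le> \<tau>" for \<tau>
  proof -
    have "(h' has_integral (h \<tau> - h 0)) {0..\<tau>}"
      using that deriv
      by (intro fundamental_theorem_of_calculus_interior continuous_on_subset[OF cont])
         (auto simp: has_real_derivative_iff_has_vector_derivative)
    then have "(h' has_integral h \<tau>) {0..\<tau>}" by (simp add: h0)
    \<comment> \<open>The sign of \<open>h'\<close> is known for positive arguments only, so the
      endpoint 0 is removed as a null set.\<close>
    then have "(h' has_integral h \<tau>) {0<..\<tau>}"
      by (rule has_integral_spike_set_eq[THEN iffD1, rotated 2])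
         (auto intro: negligible_subset[of "{0}"])
    from nn_integral_has_integral_lebesgue[OF _ this]
    have "ennreal (h \<tau>) = (\<integral>\<^sup>+t. ennreal (indicator {0<..\<tau>} t * h' t) \<partial>lborel)"
      using nonneg by simp
    also have "\<dots> = (\<integral>\<^sup>+t. (if 0 < t \<and> t \<le> \<tau> then ennreal (h' t) else 0) \<partial>lborel)"
      by (intro nn_integral_cong) (auto simp: indicator_def)
    finally show ?thesis .
  qed
  have "(\<integral>\<^sup>+y. ennreal (h (g y)) * ennreal (k y) \<partial>lborel) =
      (\<integral>\<^sup>+y. (\<integral>\<^sup>+t. (if 0 < t \<and> t \<le> g y then ennreal (h' t) else 0) * ennreal (k y) \<partial>lborel) \<partial>lborel)"
    by (intro nn_integral_cong) (subst nn_integral_multc, auto simp: h[OF g])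
  also have "\<dots> = (\<integral>\<^sup>+t. (\<integral>\<^sup>+y. (if 0 < t \<and> t \<le> g y then ennreal (h' t) else 0) * ennreal (k y) \<partial>lborel) \<partial>lborel)"
    by (rule lborel_pair.Fubini') measurable
  also have "\<dots> \<le> (\<integral>\<^sup>+t. (if 0 < t then ennreal (h' t) * T t else 0) \<partial>lborel)"
  proof (intro nn_integral_mono)
    fix t :: real
    show "(\<integral>\<^sup>+y. (if 0 < t \<and> t \<le> g y then ennreal (h' t) else 0) * ennreal (k y) \<partial>lborel)
      \<le> (if 0 < t then ennreal (h' t) * T t else 0)"
    proof (cases "0 < t")
      case True
      have "(\<integral>\<^sup>+y. (if 0 < t \<and> t \<le> g y then ennreal (h' t) else 0) * ennreal (k y) \<partial>lborel) =
          (\<integral>\<^sup>+y. ennreal (h' t) * (if t \<le> g y then ennreal (k y) else 0) \<partial>lborel)"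
        using True by (intro nn_integral_cong) auto
      also have "\<dots> = ennreal (h' t) * (\<integral>\<^sup>+y. (if t \<le> g y then ennreal (k y) else 0) \<partial>lborel)"
        by (rule nn_integral_cmult) measurable
      also have "\<dots> \<le> ennreal (h' t) * T t" by (intro mult_left_mono tail True) auto
      finally show ?thesis using True by simp
    qed simp
  qed
  finally show ?thesis .
qed

text \<open>Outside a null set the condition says that \<open>y\<close> lies in the ball of radius
  \<open>r * exp (- t)\<close> or outside the ball of radius \<open>r * exp t\<close>, where
  \<open>r = norm x\<close>. Inversion about \<open>x\<close> maps both regions to balls of the same
  radius \<open>1 / (r * (exp t - exp (- t)))\<close>, whence the factor 2.\<close>

lemma nn_integral_log_ratio_tail:
  fixes x :: "real ^ 'n"
  assumes x: "x \<noteq> 0" and t: "0 < t"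
  shows "(\<integral>\<^sup>+y. (if t \<le> \<bar>ln (norm y / norm x)\<bar> then ennreal (1 / norm (x - y) ^ (2 * CARD('n))) else 0) \<partial>lborel)
    \<le> ennreal (2 * unit_ball_vol (real CARD('n)) / norm x ^ CARD('n) * (1 / (exp t - exp (- t))) ^ CARD('n))"
proof -
  let ?k = "\<lambda>y. 1 / norm (x - y) ^ (2 * CARD('n))"
  let ?V = "unit_ball_vol (real CARD('n))"
  define r where "r = norm x"
  define d where "d = exp t - exp (- t)"
  have r: "r > 0" using x by (simp add: r_def)
  have d: "d > 0" using t by (simp add: d_def)
  define A where "A = (\<lambda>\<rho>. {y :: real ^ 'n. if \<rho> < norm x then norm y \<le> \<rho> else \<rho> \<le> norm y})"
  have [measurable]: "A \<rho> \<in> sets borel" for \<rho> unfolding A_def by measurable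
  have le: "(if t \<le> \<bar>ln (norm y / norm x)\<bar> then ennreal (?k y) else 0)
      \<le> ennreal (indicator (A (r * exp (- t))) y * ?k y) + ennreal (indicator (A (r * exp t)) y * ?k y)" for y
  proof (cases "t \<le> \<bar>ln (norm y / norm x)\<bar>")
    case True
    \<comment> \<open>Since \<open>ln 0 = 0\<close>, the origin does not satisfy the condition for
      positive \<open>t\<close>.\<close>
    then have y: "y \<noteq> 0" using t by auto
    have lt: "r * exp (- t) < r" "\<not> r * exp t < r" using r t by auto
    define L where "L = ln (norm y / norm x)"
    have "norm y = r * exp L" using y r by (simp add: r_def L_def)
    moreover have "L \<le> - t \<or> t \<le> L" using True by (auto simp: L_def)
    ultimately have "norm y \<le> r * exp (- t) \<or> r * exp t \<le> norm y" using r by simp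
    then show ?thesis using lt True by (auto simp: A_def r_def)
  qed simp
  have "(\<integral>\<^sup>+y. (if t \<le> \<bar>ln (norm y / norm x)\<bar> then ennreal (?k y) else 0) \<partial>lborel)
    \<le> (\<integral>\<^sup>+y. ennreal (indicator (A (r * exp (- t))) y * ?k y) + ennreal (indicator (A (r * exp t)) y * ?k y) \<partial>lborel)"
    by (intro nn_integral_mono le)
  also have "\<dots> = (\<integral>\<^sup>+y. ennreal (indicator (A (r * exp (- t))) y * ?k y) \<partial>lborel)
      + (\<integral>\<^sup>+y. ennreal (indicator (A (r * exp t)) y * ?k y) \<partial>lborel)"
    by (rule nn_integral_add) measurable
  also have "\<dots> = ennreal (?V * (1 / (r * d)) ^ CARD('n)) + ennreal (?V * (1 / (r * d)) ^ CARD('n))"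
  proof -
    have e: "exp t * exp (-t) = 1" by (simp add: mult_exp_exp)
    have p: "r\<^sup>2 - (r * exp (-t))\<^sup>2 = (r * exp (- t)) * (r * d)"
      using e by (simp add: d_def power2_eq_square algebra_simps)
    then have "r * exp (- t) / \<bar>r\<^sup>2 - (r * exp (-t))\<^sup>2\<bar> = 1 / (r * d)"
      unfolding p abs_mult using r d by simp
    moreover have q: "r\<^sup>2 - (r * exp t)\<^sup>2 = - ((r * exp t) * (r * d))"
      using e by (simp add: d_def power2_eq_square algebra_simps)
    then have "r * exp t / \<bar>r\<^sup>2 - (r * exp t)\<^sup>2\<bar> = 1 / (r * d)"
      unfolding q abs_mult abs_minus_cancel using r d by simp
    moreover have "r * exp (- t) \<noteq> norm x" "r * exp t \<noteq> norm x" using r t by (auto simp: r_def)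
    moreover have "(\<integral>\<^sup>+y. ennreal (indicator (A \<rho>) y * ?k y) \<partial>lborel) =
        ennreal (?V * (\<rho> / \<bar>r\<^sup>2 - \<rho>\<^sup>2\<bar>) ^ CARD('n))" if "0 \<le> \<rho>" "\<rho> \<noteq> norm x" for \<rho>
      unfolding A_def r_def by (rule nn_integral_inversion_kernel[OF that])
    ultimately show ?thesis using r by simp
  qed
  also have "\<dots> = ennreal (2 * ?V / norm x ^ CARD('n) * (1 / d) ^ CARD('n))"
  proof -
    have "?V * (1 / (r * d)) ^ CARD('n) + ?V * (1 / (r * d)) ^ CARD('n)
        = 2 * ?V / norm x ^ CARD('n) * (1 / d) ^ CARD('n)"
      by (simp add: r_def power_divide power_mult_distrib)
    moreover have "0 \<le> ?V * (1 / (r * d)) ^ CARD('n)" using r d by simp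
    ultimately show ?thesis by (metis ennreal_plus)
  qed
  finally show ?thesis unfolding d_def .
qed

section \<open>Seminorm of functions dominated by the logarithm\<close>

text \<open>Polar coordinates for radial integrands: the distribution of \<open>norm\<close> under
  Lebesgue measure is determined by its values on the half-lines \<open>{..a}\<close>, which are
  volumes of balls.\<close>

lemma nn_integral_radial:
  fixes F :: "real \<Rightarrow> ennreal"
  assumes [measurable]: "F \<in> borel_measurable borel"
  shows "(\<integral>\<^sup>+(x :: real ^ 'n). F (norm x) \<partial>lborel) =
    (\<integral>\<^sup>+t. F t * ennreal (if 0 < t then real CARD('n) * unit_ball_vol (real CARD('n)) * t ^ (CARD('n) - 1) else 0) \<partial>lborel)"
proof -
  let ?V = "unit_ball_vol (real CARD('n))"
  let ?d = "\<lambda>t. ennreal (if 0 < t then real CARD('n) * ?V * t ^ (CARD('n) - 1) else 0)"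
  let ?M = "distr lborel borel (norm :: real ^ 'n \<Rightarrow> real)"
  let ?N = "density lborel ?d"
  have cdf: "emeasure ?M {..a} = ennreal (if 0 \<le> a then ?V * a ^ CARD('n) else 0)" for a
  proof -
    have "emeasure ?M {..a} = emeasure lborel (cball (0 :: real ^ 'n) a)"
      by (subst emeasure_distr) (auto simp: cball_def intro!: arg_cong[where f = "emeasure lborel"])
    then show ?thesis by (auto simp: emeasure_cball)
  qed
  have "?M = ?N"
  proof (rule measure_eqI_generator_eq[where E = "range atMost" and \<Omega> = UNIV and A = "\<lambda>i. {..real i}"])
    show "Int_stable (range (atMost :: real \<Rightarrow> real set))"
      by (auto simp: Int_stable_def)
    show "emeasure ?M X = emeasure ?N X" if X: "X \<in> range atMost" for X
    proof -
      obtain a where a: "X = {..a}" using X by auto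
      have "emeasure ?N {..a} = (\<integral>\<^sup>+t. ?d t * indicator {..a} t \<partial>lborel)"
        by (rule emeasure_density) auto
      also have "\<dots> = ennreal (if 0 \<le> a then ?V * a ^ CARD('n) else 0)"
      proof (cases "0 \<le> a")
        case True
        have "(\<integral>\<^sup>+t. ?d t * indicator {..a} t \<partial>lborel) =
            (\<integral>\<^sup>+t. ennreal (real CARD('n) * ?V * t ^ (CARD('n) - 1)) * indicator {0..a} t \<partial>lborel)"
        \<comment> \<open>In dimension one the integrands differ at \<open>t = 0\<close>, because
          \<open>0 ^ 0 = 1\<close>; hence equality only almost everywhere.\<close>
        proof (rule nn_integral_cong_AE)
          have "AE t in lborel. t \<noteq> (0::real)" by (rule AE_lborel_singleton)
          then show "AE t in lborel. ?d t * indicator {..a} t =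
              ennreal (real CARD('n) * ?V * t ^ (CARD('n) - 1)) * indicator {0..a} t"
            by eventually_elim (auto simp: indicator_def)
        qed
        also have "\<dots> = ennreal (?V * a ^ CARD('n) - ?V * 0 ^ CARD('n))"
          using True by (intro nn_integral_FTC_Icc) (auto intro!: derivative_eq_intros)
        finally show ?thesis using True by simp
      next
        case False
        then show ?thesis by (auto simp: nn_integral_0_iff_AE indicator_def)
      qed
      finally show ?thesis unfolding a cdf ..
    qed
    show "sets ?M = sigma_sets UNIV (range atMost)" "sets ?N = sigma_sets UNIV (range atMost)"
      by (simp_all add: borel_eq_atMost[where 'a = real])
    show "(\<Union>i. {..real i}) = (UNIV :: real set)"
      by (auto intro: real_arch_simple)
    show "emeasure ?M {..real i} \<noteq> \<infinity>" for i by (simp add: cdf)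
  qed auto
  moreover have "(\<integral>\<^sup>+(x :: real ^ 'n). F (norm x) \<partial>lborel) = (\<integral>\<^sup>+t. F t \<partial>?M)"
    by (rule nn_integral_distr[symmetric]) auto
  moreover have "(\<integral>\<^sup>+t. F t \<partial>?N) = (\<integral>\<^sup>+t. ?d t * F t \<partial>lborel)"
    by (rule nn_integral_density) auto
  ultimately show ?thesis by (simp add: mult.commute)
qed

lemma power_pred_divide:
  assumes "0 < (t::real)" "0 < n" shows "t ^ (n - 1) / t ^ n = 1 / t"
  using assms by (cases n) auto

text \<open>The coefficient is the surface measure of the unit sphere. This is the only contribution
  to the seminorm that grows as \<open>\<epsilon>\<close> tends to 0.\<close>

lemma nn_integral_annulus:
  assumes "0 < \<epsilon>" "\<epsilon> \<le> R"
  shows "(\<integral>\<^sup>+(x :: real ^ 'n). ennreal (if \<epsilon> \<le> norm x \<and> norm x \<le> R then 1 / norm x ^ CARD('n) else 0) \<partial>lborel)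
    = ennreal (real CARD('n) * unit_ball_vol (real CARD('n)) * ln (R / \<epsilon>))"
proof -
  let ?c = "real CARD('n) * unit_ball_vol (real CARD('n))"
  have "(\<integral>\<^sup>+(x :: real ^ 'n). ennreal (if \<epsilon> \<le> norm x \<and> norm x \<le> R then 1 / norm x ^ CARD('n) else 0) \<partial>lborel)
    = (\<integral>\<^sup>+t. ennreal (if \<epsilon> \<le> t \<and> t \<le> R then 1 / t ^ CARD('n) else 0)
        * ennreal (if 0 < t then ?c * t ^ (CARD('n) - 1) else 0) \<partial>lborel)"
    by (subst nn_integral_radial[symmetric]) auto
  also have "\<dots> = (\<integral>\<^sup>+t. ennreal (?c / t) * indicator {\<epsilon>..R} t \<partial>lborel)"
  proof (intro nn_integral_cong)
    fix t :: real
    show "ennreal (if \<epsilon> \<le> t \<and> t \<le> R then 1 / t ^ CARD('n) else 0)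
        * ennreal (if 0 < t then ?c * t ^ (CARD('n) - 1) else 0)
      = ennreal (?c / t) * indicator {\<epsilon>..R} t"
    proof (cases "\<epsilon> \<le> t \<and> t \<le> R")
      case True
      then have t: "0 < t" using assms by simp
      have "1 / t ^ CARD('n) * (?c * t ^ (CARD('n) - 1)) = ?c * (t ^ (CARD('n) - 1) / t ^ CARD('n))" by simp
      also have "\<dots> = ?c / t"
        using t by (subst power_pred_divide) auto
      finally show ?thesis using t True by (simp add: ennreal_mult[symmetric])
    qed auto
  qed
  also have "\<dots> = ennreal (?c * ln R - ?c * ln \<epsilon>)"
    using assms by (intro nn_integral_FTC_Icc) (auto intro!: derivative_eq_intros)
  also have "?c * ln R - ?c * ln \<epsilon> = ?c * ln (R / \<epsilon>)"
    using assms by (simp add: ln_div right_diff_distrib)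
  finally show ?thesis .
qed

text \<open>The square root makes the scale invariant weight integrable at infinity, and scaling
  makes the bound independent of \<open>R\<close>.\<close>

lemma nn_integral_exterior:
  assumes "0 < R"
  shows "(\<integral>\<^sup>+(x :: real ^ 'n). ennreal (if R < norm x then (R / norm x) powr (1 / 2) / norm x ^ CARD('n) else 0) \<partial>lborel)
    \<le> ennreal (2 * real CARD('n) * unit_ball_vol (real CARD('n)))"
proof -
  let ?c = "real CARD('n) * unit_ball_vol (real CARD('n))"
  have "(\<integral>\<^sup>+(x :: real ^ 'n). ennreal (if R < norm x then (R / norm x) powr (1 / 2) / norm x ^ CARD('n) else 0) \<partial>lborel)
    = (\<integral>\<^sup>+t. ennreal (if R < t then (R / t) powr (1 / 2) / t ^ CARD('n) else 0)
        * ennreal (if 0 < t then ?c * t ^ (CARD('n) - 1) else 0) \<partial>lborel)"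
    by (subst nn_integral_radial[symmetric]) auto
  also have "\<dots> \<le> (\<integral>\<^sup>+t. ennreal (?c * R powr (1 / 2) * t powr (- 3 / 2)) * indicator {R..} t \<partial>lborel)"
  proof (intro nn_integral_mono)
    fix t :: real
    show "ennreal (if R < t then (R / t) powr (1 / 2) / t ^ CARD('n) else 0)
        * ennreal (if 0 < t then ?c * t ^ (CARD('n) - 1) else 0)
      \<le> ennreal (?c * R powr (1 / 2) * t powr (- 3 / 2)) * indicator {R..} t"
    proof (cases "R < t")
      case True
      then have t: "0 < t" using assms by simp
      have "(R / t) powr (1 / 2) / t ^ CARD('n) * (?c * t ^ (CARD('n) - 1))
          = ?c * (R / t) powr (1 / 2) * (t ^ (CARD('n) - 1) / t ^ CARD('n))" by simp
      also have "\<dots> = ?c * (R / t) powr (1 / 2) * (1 / t)"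
        using t by (subst power_pred_divide) auto
      also have "\<dots> = ?c * R powr (1 / 2) * t powr (- 3 / 2)"
      proof -
        have "(R / t) powr (1 / 2) = R powr (1 / 2) * t powr (- 1 / 2)"
          using t assms by (simp add: powr_divide powr_minus_divide)
        moreover have "t powr (- 3 / 2) = t powr (- 1 / 2) * (1 / t)"
          using t powr_add[of t "- 1 / 2" "- 1"] by (simp add: powr_minus_divide)
        ultimately show ?thesis by simp
      qed
      finally show ?thesis using t True by (simp add: ennreal_mult[symmetric])
    qed simp
  qed
  also have "\<dots> = ennreal (0 - (- (2 * ?c * R powr (1 / 2) * R powr (- 1 / 2))))"
  proof (rule nn_integral_FTC_atLeast[where F = "\<lambda>t. - (2 * ?c * R powr (1 / 2) * t powr (- 1 / 2))"])
    show "((\<lambda>t. - (2 * ?c * R powr (1 / 2) * t powr (- 1 / 2))) has_real_derivative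
        ?c * R powr (1 / 2) * t powr (- 3 / 2)) (at t)" if "R \<le> t" for t
      using that assms by (auto intro!: derivative_eq_intros)
    have "((\<lambda>t. t powr (- 1 / 2)) \<longlongrightarrow> (0::real)) at_top"
      by (rule tendsto_neg_powr) (auto simp: filterlim_ident)
    from tendsto_mult_left[OF this, of "- (2 * ?c * R powr (1 / 2))"]
    show "((\<lambda>t. - (2 * ?c * R powr (1 / 2) * t powr (- 1 / 2))) \<longlongrightarrow> 0) at_top"
      by simp
  qed auto
  also have "\<dots> = ennreal (2 * real CARD('n) * unit_ball_vol (real CARD('n)))"
    using assms by (simp add: powr_minus)
  finally show ?thesis .
qed

text \<open>Counterpart at the origin of the exterior estimate. It serves twice: for the core of
  radius \<open>\<epsilon>\<close> in the seminorm and, with \<open>R\<close> as radius, for the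
  p-th powers of the Lebesgue norms.\<close>

lemma nn_integral_interior:
  assumes "0 < \<epsilon>"
  shows "(\<integral>\<^sup>+(x :: real ^ 'n). ennreal (if norm x < \<epsilon> then (norm x / \<epsilon>) powr (1 / 2) / norm x ^ CARD('n) else 0) \<partial>lborel)
    \<le> ennreal (2 * real CARD('n) * unit_ball_vol (real CARD('n)))"
proof -
  let ?c = "real CARD('n) * unit_ball_vol (real CARD('n))"
  have "(\<integral>\<^sup>+(x :: real ^ 'n). ennreal (if norm x < \<epsilon> then (norm x / \<epsilon>) powr (1 / 2) / norm x ^ CARD('n) else 0) \<partial>lborel)
    = (\<integral>\<^sup>+t. ennreal (if t < \<epsilon> then (t / \<epsilon>) powr (1 / 2) / t ^ CARD('n) else 0)
        * ennreal (if 0 < t then ?c * t ^ (CARD('n) - 1) else 0) \<partial>lborel)"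
    by (subst nn_integral_radial[symmetric]) auto
  also have "\<dots> \<le> (\<integral>\<^sup>+t. ennreal (?c * \<epsilon> powr (- 1 / 2)) * ennreal (indicator {0..\<epsilon>} t * t powr (- 1 / 2)) \<partial>lborel)"
  proof (intro nn_integral_mono)
    fix t :: real
    show "ennreal (if t < \<epsilon> then (t / \<epsilon>) powr (1 / 2) / t ^ CARD('n) else 0)
        * ennreal (if 0 < t then ?c * t ^ (CARD('n) - 1) else 0)
      \<le> ennreal (?c * \<epsilon> powr (- 1 / 2)) * ennreal (indicator {0..\<epsilon>} t * t powr (- 1 / 2))"
    proof (cases "0 < t \<and> t < \<epsilon>")
      case True
      then have t: "0 < t" by simp
      have "(t / \<epsilon>) powr (1 / 2) / t ^ CARD('n) * (?c * t ^ (CARD('n) - 1))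
          = ?c * (t / \<epsilon>) powr (1 / 2) * (t ^ (CARD('n) - 1) / t ^ CARD('n))" by simp
      also have "\<dots> = ?c * (t / \<epsilon>) powr (1 / 2) * (1 / t)"
        using t by (subst power_pred_divide) auto
      also have "\<dots> = ?c * \<epsilon> powr (- 1 / 2) * t powr (- 1 / 2)"
      proof -
        have "(t / \<epsilon>) powr (1 / 2) = \<epsilon> powr (- 1 / 2) * t powr (1 / 2)"
          using t assms by (simp add: powr_divide powr_minus_divide)
        moreover have "t powr (- 1 / 2) = t powr (1 / 2) * (1 / t)"
          using t powr_add[of t "1 / 2" "- 1"] by (simp add: powr_minus_divide)
        ultimately show ?thesis by simp
      qed
      finally show ?thesis using True by (simp add: ennreal_mult[symmetric])
    qed auto
  qed
  also have "\<dots> = ennreal (?c * \<epsilon> powr (- 1 / 2)) * (\<integral>\<^sup>+t. ennreal (indicator {0..\<epsilon>} t * t powr (- 1 / 2)) \<partial>lborel)"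
    by (rule nn_integral_cmult) measurable
  also have "(\<integral>\<^sup>+t. ennreal (indicator {0..\<epsilon>} t * t powr (- 1 / 2)) \<partial>lborel) = ennreal (\<epsilon> powr (- 1 / 2 + 1) / (- 1 / 2 + 1))"
    by (rule nn_integral_has_integral_lebesgue[OF _ has_integral_powr_from_0]) (use assms in auto)
  also have "ennreal (?c * \<epsilon> powr (- 1 / 2)) * \<dots> = ennreal (2 * real CARD('n) * unit_ball_vol (real CARD('n)))"
    using assms by (simp add: ennreal_mult[symmetric] powr_minus)
  finally show ?thesis .
qed

text \<open>Kept general in \<open>h\<close> because two choices occur: \<open>t powr p\<close>,
  which yields the sharp constant, and \<open>t powr p * exp (t / 2)\<close>, which pays for the
  decay weights.\<close>

lemma nn_integral_log_ratio_le:
  fixes x :: "real ^ 'n"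
  assumes x: "x \<noteq> 0"
    and [measurable]: "h' \<in> borel_measurable borel"
    and cont: "continuous_on {0..} h" and h0: "h 0 = 0"
    and deriv: "\<And>t. 0 < t \<Longrightarrow> (h has_real_derivative h' t) (at t)"
    and nonneg: "\<And>t. 0 < t \<Longrightarrow> 0 \<le> h' t"
  shows "(\<integral>\<^sup>+y. ennreal (h \<bar>ln (norm y / norm x)\<bar>) * ennreal (1 / norm (x - y) ^ (2 * CARD('n))) \<partial>lborel)
    \<le> ennreal (2 * unit_ball_vol (real CARD('n)) / norm x ^ CARD('n)) *
      (\<integral>\<^sup>+t. ennreal (if 0 < t then h' t * (1 / (exp t - exp (- t))) ^ CARD('n) else 0) \<partial>lborel)"
proof -
  let ?V = "unit_ball_vol (real CARD('n))"
  let ?T = "\<lambda>t. ennreal (2 * ?V / norm x ^ CARD('n) * (1 / (exp t - exp (- t))) ^ CARD('n))"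
  have "(\<integral>\<^sup>+y. ennreal (h \<bar>ln (norm y / norm x)\<bar>) * ennreal (1 / norm (x - y) ^ (2 * CARD('n))) \<partial>lborel)
    \<le> (\<integral>\<^sup>+t. (if 0 < t then ennreal (h' t) * ?T t else 0) \<partial>lborel)"
    by (rule nn_integral_layer_cake_le[OF _ _ _ _ cont h0 deriv nonneg nn_integral_log_ratio_tail[OF x]]) auto
  also have "\<dots> = (\<integral>\<^sup>+t. ennreal (2 * ?V / norm x ^ CARD('n)) *
      ennreal (if 0 < t then h' t * (1 / (exp t - exp (- t))) ^ CARD('n) else 0) \<partial>lborel)"
    using nonneg
    by (intro nn_integral_cong) (auto simp: ennreal_mult[symmetric] mult_ac)
  also have "\<dots> = ennreal (2 * ?V / norm x ^ CARD('n)) *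
      (\<integral>\<^sup>+t. ennreal (if 0 < t then h' t * (1 / (exp t - exp (- t))) ^ CARD('n) else 0) \<partial>lborel)"
    by (rule nn_integral_cmult) measurable
  finally show ?thesis .
qed

text \<open>The sphere measure is \<open>n * ?V\<close> and
  \<open>fact n = n * fact (n - 1)\<close>, so the prefactors agree. The point to settle is
  convergence: \<open>gamma_const\<close> contains a real \<open>suminf\<close>, which agrees with
  the extended sum only once summability is known.\<close>

lemma
  fixes n :: nat
  assumes n: "0 < n" and s: "0 < s" "s < 1" and p: "s * p = real n"
  shows nn_integral_gamma_const: "(\<integral>\<^sup>+t. ennreal (if 0 < t then p * t powr (p - 1) * (1 / (exp t - exp (- t))) ^ n else 0) \<partial>lborel)
      = ennreal (gamma_const s n / (2 * real n * (unit_ball_vol (real n))\<^sup>2))" (is ?int)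
    and gamma_const_pos: "0 < gamma_const s n" (is ?pos)
proof -
  let ?V = "unit_ball_vol (real n)"
  define a where "a = (\<lambda>k. Gamma (p + 1) / fact (n - 1) * (fact (n + k - 1) / (fact k * real (n + 2 * k) powr p)))"
  have p': "p = real n / s" using s p by (simp add: field_simps)
  have np: "real n < p" using s n unfolding p' by (simp add: less_divide_eq)
  have a_pos: "0 < a k" for k
    using np n unfolding a_def by (intro mult_pos_pos divide_pos_pos Gamma_real_pos) auto
  have V: "0 < ?V" by simp
  then have V': "?V \<noteq> 0" by linarith
  let ?I = "\<integral>\<^sup>+t. ennreal (if 0 < t then p * t powr (p - 1) * (1 / (exp t - exp (- t))) ^ n else 0) \<partial>lborel"
  have I: "?I = (\<Sum>k. ennreal (a k))"
    unfolding a_def using np n by (intro nn_integral_powr_two_sinh) auto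
  \<comment> \<open>Comparison with the finite weighted integral yields summability without any
    estimate of the terms of the series.\<close>
  have "?I \<le> (\<integral>\<^sup>+t. ennreal (if 0 < t then (p * t powr (p - 1) + t powr p / 2) * exp (t / 2)
      * (1 / (exp t - exp (- t))) ^ n else 0) \<partial>lborel)"
  proof (intro nn_integral_mono ennreal_leI)
    fix t :: real
    have "p * t powr (p - 1) * 1 \<le> (p * t powr (p - 1) + t powr p / 2) * exp (t / 2)" if "0 < t"
      using that np by (intro mult_mono) auto
    moreover have "(1 / (exp t - exp (- t))) ^ n \<ge> 0" if "0 < t" using that by simp
    ultimately show "(if 0 < t then p * t powr (p - 1) * (1 / (exp t - exp (- t))) ^ n else 0)
      \<le> (if 0 < t then (p * t powr (p - 1) + t powr p / 2) * exp (t / 2)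
      * (1 / (exp t - exp (- t))) ^ n else 0)"
      by (auto intro!: mult_right_mono)
  qed
  also have "\<dots> < \<infinity>" by (rule nn_integral_powr_exp_two_sinh_finite[OF np n])
  finally have fin: "(\<Sum>k. ennreal (a k)) \<noteq> top" unfolding I by simp
  have summable: "summable a"
    by (rule summable_suminf_not_top[OF _ fin]) (simp add: a_pos less_imp_le)
  have I': "?I = ennreal (suminf a)"
    unfolding I using a_pos fin by (intro suminf_ennreal) (simp_all add: less_imp_le)
  have "suminf a = Gamma (p + 1) / fact (n - 1) * (\<Sum>k. fact (n + k - 1) / (fact k * real (n + 2 * k) powr p))"
  proof -
    have "summable (\<lambda>k. fact (n + k - 1) / (fact k * real (n + 2 * k) powr p))"
    proof -
      have "0 < Gamma (p + 1)" using np by (intro Gamma_real_pos) simp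
      then have "Gamma (p + 1) / fact (n - 1) \<noteq> 0" by simp
      then show ?thesis using summable unfolding a_def by (simp only: summable_cmult_iff) simp
    qed
    then show ?thesis unfolding a_def by (rule suminf_mult)
  qed
  moreover have "sphere_measure n = real n * ?V"
    by (simp add: sphere_measure_def unit_ball_vol_def add.commute)
  moreover have "fact n = real n * fact (n - 1)" using n by (simp add: fact_reduce)
  ultimately have g: "gamma_const s n = 2 * real n * ?V\<^sup>2 * suminf a"
    using n unfolding gamma_const_def p'[symmetric] Let_def by (simp add: power2_eq_square field_simps)
  have "0 < suminf a" by (rule suminf_pos[OF summable a_pos])
  then show ?pos unfolding g using n V by (intro mult_pos_pos zero_less_power) auto
  show ?int unfolding I' using n V' by (simp add: g)
qed

text \<open>For \<open>\<epsilon> \<le> norm x \<le> R\<close> the logarithmic bound is integrated exactly and gives the constant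
  \<open>gamma_const\<close>; elsewhere the extra decay makes the contribution bounded uniformly in \<open>\<epsilon>\<close>.\<close>

lemma gagliardo_log_radial_le:
  assumes n: "n = CARD('n)" and s: "0 < s" "s < 1" and p: "s * p = real n"
  obtains C where "0 < C" and
    "\<And>(u :: real ^ 'n \<Rightarrow> real) \<epsilon> R. \<lbrakk>u \<in> borel_measurable borel; 0 < \<epsilon>; \<epsilon> \<le> R;
      \<And>x y. x \<noteq> 0 \<Longrightarrow> y \<noteq> 0 \<Longrightarrow> \<bar>u y - u x\<bar> powr p \<le> \<bar>ln (norm y / norm x)\<bar> powr p;
      \<And>x y. x \<noteq> 0 \<Longrightarrow> y \<noteq> 0 \<Longrightarrow> norm x < \<epsilon> \<Longrightarrow> \<bar>u y - u x\<bar> powr p \<le>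
        \<bar>ln (norm y / norm x)\<bar> powr p * exp (\<bar>ln (norm y / norm x)\<bar> / 2) * (norm x / \<epsilon>) powr (1 / 2);
      \<And>x y. x \<noteq> 0 \<Longrightarrow> y \<noteq> 0 \<Longrightarrow> R < norm x \<Longrightarrow> \<bar>u y - u x\<bar> powr p \<le>
        \<bar>ln (norm y / norm x)\<bar> powr p * exp (\<bar>ln (norm y / norm x)\<bar> / 2) * (R / norm x) powr (1 / 2)\<rbrakk>
    \<Longrightarrow> (\<integral>\<^sup>+x. (\<integral>\<^sup>+y. ennreal (\<bar>u y - u x\<bar> powr p / norm (y - x) ^ (2 * n)) \<partial>lborel) \<partial>lborel)
      \<le> ennreal (gamma_const s n * ln (R / \<epsilon>) + C)"
proof -
  let ?V = "unit_ball_vol (real n)"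
  have n0: "0 < n" using n by simp
  have "p = real n / s" using s p by (simp add: field_simps)
  then have np: "real n < p" using s n0 by (simp add: less_divide_eq)
  then have p0: "0 < p" by simp
  let ?I = "\<integral>\<^sup>+t. ennreal (if 0 < t then (p * t powr (p - 1) + t powr p / 2) * exp (t / 2)
      * (1 / (exp t - exp (- t))) ^ n else 0) \<partial>lborel"
  define M where "M = 2 * ?V * enn2real ?I"
  have I: "?I = ennreal (enn2real ?I)"
    using nn_integral_powr_exp_two_sinh_finite[OF np n0] by simp
  have M0: "0 \<le> M" by (simp add: M_def)
  \<comment> \<open>This is \<open>2 * ?V\<close> times the value in
    \<open>nn_integral_gamma_const\<close>. The denominator is the sphere measure, which the
    integral over the annulus puts back.\<close>
  define G where "G = gamma_const s n / (real n * ?V)"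
  have G0: "0 \<le> G" using gamma_const_pos[OF n0 s p] by (simp add: G_def)
  have cont: "continuous_on {0..} (\<lambda>t::real. t powr p)"
    using p0 by (intro continuous_on_powr') (auto intro!: continuous_intros)
  have deriv: "((\<lambda>t. t powr p) has_real_derivative p * t powr (p - 1)) (at t)" if "0 < t" for t :: real
    using that by (rule has_real_derivative_powr)
  have deriv': "((\<lambda>t. t powr p * exp (t / 2)) has_real_derivative
      (p * t powr (p - 1) + t powr p / 2) * exp (t / 2)) (at t)" if "0 < t" for t :: real
  proof -
    have "((\<lambda>t. exp (t / 2)) has_real_derivative exp (t / 2) / 2) (at t)"
      by (auto intro!: derivative_eq_intros)
    from DERIV_mult[OF deriv[OF that] this] show ?thesis by (simp add: algebra_simps)
  qed
  have G: "(\<integral>\<^sup>+y. ennreal (\<bar>ln (norm y / norm x)\<bar> powr p) * ennreal (1 / norm (x - y) ^ (2 * n)) \<partial>lborel)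
      \<le> ennreal (G / norm x ^ n)" if "x \<noteq> 0" for x :: "real ^ 'n"
  proof -
    have "(\<integral>\<^sup>+y. ennreal (\<bar>ln (norm y / norm x)\<bar> powr p) * ennreal (1 / norm (x - y) ^ (2 * n)) \<partial>lborel)
      \<le> ennreal (2 * ?V / norm x ^ n) *
      (\<integral>\<^sup>+t. ennreal (if 0 < t then p * t powr (p - 1) * (1 / (exp t - exp (- t))) ^ n else 0) \<partial>lborel)"
      unfolding n using p0
      by (intro nn_integral_log_ratio_le[where h = "\<lambda>t. t powr p"] that cont deriv) auto
    also have "\<dots> = ennreal (2 * ?V / norm x ^ n * (gamma_const s n / (2 * real n * ?V\<^sup>2)))"
      unfolding nn_integral_gamma_const[OF n0 s p] using gamma_const_pos[OF n0 s p]
      by (intro ennreal_mult[symmetric]) auto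
    also have "2 * ?V / norm x ^ n * (gamma_const s n / (2 * real n * ?V\<^sup>2)) = G / norm x ^ n"
      by (simp add: G_def power2_eq_square)
    finally show ?thesis .
  qed
  have M: "(\<integral>\<^sup>+y. ennreal (\<bar>ln (norm y / norm x)\<bar> powr p * exp (\<bar>ln (norm y / norm x)\<bar> / 2)) *
      ennreal (1 / norm (x - y) ^ (2 * n)) \<partial>lborel) \<le> ennreal (M / norm x ^ n)" if "x \<noteq> 0" for x :: "real ^ 'n"
  proof -
    have "(\<integral>\<^sup>+y. ennreal (\<bar>ln (norm y / norm x)\<bar> powr p * exp (\<bar>ln (norm y / norm x)\<bar> / 2)) *
      ennreal (1 / norm (x - y) ^ (2 * n)) \<partial>lborel) \<le> ennreal (2 * ?V / norm x ^ n) * ?I"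
      unfolding n using p0
      by (intro nn_integral_log_ratio_le[where h = "\<lambda>t. t powr p * exp (t / 2)"] that deriv')
         (auto intro!: continuous_intros cont)
    also have "\<dots> = ennreal (2 * ?V / norm x ^ n * enn2real ?I)"
      by (subst I, rule ennreal_mult[symmetric]) auto
    also have "2 * ?V / norm x ^ n * enn2real ?I = M / norm x ^ n"
      by (simp add: M_def)
    finally show ?thesis .
  qed
  \<comment> \<open>The 4 adds the bounds 2 for the core and 2 for the exterior; the summand 1 only
    serves to make \<open>C\<close> positive.\<close>
  define C where "C = 1 + M * (4 * real n * ?V)"
  show thesis
  proof (rule that[of C])
    show "0 < C" using M0 by (auto simp: C_def intro!: add_pos_nonneg mult_nonneg_nonneg)
    fix u :: "real ^ 'n \<Rightarrow> real" and \<epsilon> R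
    assume [measurable]: "u \<in> borel_measurable borel" and \<epsilon>: "0 < \<epsilon>" "\<epsilon> \<le> R"
      and ua: "\<And>x y. x \<noteq> 0 \<Longrightarrow> y \<noteq> 0 \<Longrightarrow> \<bar>u y - u x\<bar> powr p \<le> \<bar>ln (norm y / norm x)\<bar> powr p"
      and ub: "\<And>x y. x \<noteq> 0 \<Longrightarrow> y \<noteq> 0 \<Longrightarrow> norm x < \<epsilon> \<Longrightarrow> \<bar>u y - u x\<bar> powr p \<le>
        \<bar>ln (norm y / norm x)\<bar> powr p * exp (\<bar>ln (norm y / norm x)\<bar> / 2) * (norm x / \<epsilon>) powr (1 / 2)"
      and uc: "\<And>x y. x \<noteq> 0 \<Longrightarrow> y \<noteq> 0 \<Longrightarrow> R < norm x \<Longrightarrow> \<bar>u y - u x\<bar> powr p \<le>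
        \<bar>ln (norm y / norm x)\<bar> powr p * exp (\<bar>ln (norm y / norm x)\<bar> / 2) * (R / norm x) powr (1 / 2)"
    let ?D = "\<lambda>x y. ennreal (\<bar>u y - u x\<bar> powr p / norm (y - x) ^ (2 * n))"
    let ?W1 = "\<lambda>x :: real ^ 'n. ennreal (if norm x < \<epsilon> then (norm x / \<epsilon>) powr (1 / 2) / norm x ^ n else 0)"
    let ?W2 = "\<lambda>x :: real ^ 'n. ennreal (if \<epsilon> \<le> norm x \<and> norm x \<le> R then 1 / norm x ^ n else 0)"
    let ?W3 = "\<lambda>x :: real ^ 'n. ennreal (if R < norm x then (R / norm x) powr (1 / 2) / norm x ^ n else 0)"
    \<comment> \<open>One estimate for all three regions: \<open>H\<close> is one of the two
      functions of the log ratio and \<open>c\<close> the decay weight (1 on the annulus), which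
      depends on \<open>x\<close> only and so leaves the inner integral.\<close>
    have weighted: "(\<integral>\<^sup>+y. ?D x y \<partial>lborel) \<le> ennreal (c * (B / norm x ^ n))"
      if x: "x \<noteq> 0" and c: "0 \<le> c" "0 \<le> B" and [measurable]: "H \<in> borel_measurable borel"
        and le: "\<And>y. y \<noteq> 0 \<Longrightarrow> \<bar>u y - u x\<bar> powr p \<le> H y * c"
        and H: "(\<integral>\<^sup>+y. ennreal (H y) * ennreal (1 / norm (x - y) ^ (2 * n)) \<partial>lborel) \<le> ennreal (B / norm x ^ n)"
      for x H c B
    proof -
      have "(\<integral>\<^sup>+y. ?D x y \<partial>lborel) \<le>
          (\<integral>\<^sup>+y. ennreal c * (ennreal (H y) * ennreal (1 / norm (x - y) ^ (2 * n))) \<partial>lborel)"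
      proof (rule nn_integral_mono_AE)
        have "AE y in lborel. y \<noteq> (0 :: real ^ 'n)" by (rule AE_lborel_singleton)
        then show "AE y in lborel. ?D x y \<le> ennreal c * (ennreal (H y) * ennreal (1 / norm (x - y) ^ (2 * n)))"
        proof eventually_elim
          case (elim y)
          have "?D x y \<le> ennreal (H y * c / norm (x - y) ^ (2 * n))"
            using le[OF elim] by (intro ennreal_leI) (simp add: norm_minus_commute divide_right_mono)
          also have "\<dots> = ennreal (c * (1 / norm (x - y) ^ (2 * n)) * H y)" by (simp add: mult_ac)
          also have "\<dots> = ennreal (c * (1 / norm (x - y) ^ (2 * n))) * ennreal (H y)"
            using c by (intro ennreal_mult') auto
          also have "ennreal (c * (1 / norm (x - y) ^ (2 * n))) = ennreal c * ennreal (1 / norm (x - y) ^ (2 * n))"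
            using c by (intro ennreal_mult')
          finally show ?case by (simp add: mult_ac)
        qed
      qed
      also have "\<dots> = ennreal c * (\<integral>\<^sup>+y. ennreal (H y) * ennreal (1 / norm (x - y) ^ (2 * n)) \<partial>lborel)"
        by (rule nn_integral_cmult) measurable
      also have "\<dots> \<le> ennreal c * ennreal (B / norm x ^ n)" by (intro mult_left_mono H) auto
      also have "\<dots> = ennreal (c * (B / norm x ^ n))" using c by (intro ennreal_mult[symmetric]) auto
      finally show ?thesis .
    qed
    have pt: "(\<integral>\<^sup>+y. ?D x y \<partial>lborel) \<le> ennreal M * ?W1 x + (ennreal G * ?W2 x + ennreal M * ?W3 x)"
      if x: "x \<noteq> 0" for x
    proof -
      consider "norm x < \<epsilon>" | "\<epsilon> \<le> norm x" "norm x \<le> R" | "R < norm x" by linarith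
      then show ?thesis
      proof cases
        case 1
        have "(\<integral>\<^sup>+y. ?D x y \<partial>lborel) \<le> ennreal ((norm x / \<epsilon>) powr (1 / 2) * (M / norm x ^ n))"
          by (rule weighted[OF x _ M0 _ _ M[OF x]]) (use ub[OF x _ 1] in auto)
        also have "\<dots> = ennreal M * ?W1 x"
          using 1 M0 by (simp add: ennreal_mult[symmetric] mult_ac)
        finally show ?thesis using 1 \<epsilon> by simp
      next
        case 2
        have "(\<integral>\<^sup>+y. ?D x y \<partial>lborel) \<le> ennreal (1 * (G / norm x ^ n))"
          by (rule weighted[OF x _ G0 _ _ G[OF x]]) (use ua[OF x] in auto)
        also have "\<dots> = ennreal G * ?W2 x"
          using 2 G0 by (simp add: ennreal_mult[symmetric])
        finally show ?thesis using 2 by simp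
      next
        case 3
        have "(\<integral>\<^sup>+y. ?D x y \<partial>lborel) \<le> ennreal ((R / norm x) powr (1 / 2) * (M / norm x ^ n))"
          by (rule weighted[OF x _ M0 _ _ M[OF x]]) (use uc[OF x _ 3] in auto)
        also have "\<dots> = ennreal M * ?W3 x"
          using 3 M0 by (simp add: ennreal_mult[symmetric] mult_ac)
        finally show ?thesis using 3 \<epsilon> by simp
      qed
    qed
    have "(\<integral>\<^sup>+x. (\<integral>\<^sup>+y. ?D x y \<partial>lborel) \<partial>lborel) \<le>
        (\<integral>\<^sup>+x. ennreal M * ?W1 x + (ennreal G * ?W2 x + ennreal M * ?W3 x) \<partial>lborel)"
    proof (rule nn_integral_mono_AE)
      have "AE x in lborel. x \<noteq> (0 :: real ^ 'n)" by (rule AE_lborel_singleton)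
      then show "AE x in lborel. (\<integral>\<^sup>+y. ?D x y \<partial>lborel) \<le>
          ennreal M * ?W1 x + (ennreal G * ?W2 x + ennreal M * ?W3 x)"
        by eventually_elim (rule pt)
    qed
    also have "\<dots> = ennreal M * (\<integral>\<^sup>+x. ?W1 x \<partial>lborel) +
        (ennreal G * (\<integral>\<^sup>+x. ?W2 x \<partial>lborel) + ennreal M * (\<integral>\<^sup>+x. ?W3 x \<partial>lborel))"
      by (simp add: nn_integral_add nn_integral_cmult)
    also have "\<dots> \<le> ennreal M * ennreal (2 * real n * ?V) +
        (ennreal G * ennreal (real n * ?V * ln (R / \<epsilon>)) + ennreal M * ennreal (2 * real n * ?V))"
      unfolding n using \<epsilon>
      by (intro add_mono mult_left_mono nn_integral_interior nn_integral_exterior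
          eq_refl[OF nn_integral_annulus]) auto
    also have "\<dots> = ennreal (M * (2 * real n * ?V) + (G * (real n * ?V * ln (R / \<epsilon>)) + M * (2 * real n * ?V)))"
      using M0 G0 \<epsilon> by (simp add: ennreal_mult[symmetric] ennreal_plus[symmetric] del: ennreal_plus)
    also have "\<dots> \<le> ennreal (gamma_const s n * ln (R / \<epsilon>) + C)"
    proof (rule ennreal_leI)
      have "?V > 0" by simp
      then have "?V \<noteq> 0" by linarith
      then have "G * (real n * ?V * ln (R / \<epsilon>)) = gamma_const s n * ln (R / \<epsilon>)"
        using n0 unfolding G_def by simp
      moreover have "M * (4 * real n * ?V) = M * (2 * real n * ?V) + M * (2 * real n * ?V)" by simp
      ultimately show "M * (2 * real n * ?V) + (G * (real n * ?V * ln (R / \<epsilon>)) + M * (2 * real n * ?V))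
        \<le> gamma_const s n * ln (R / \<epsilon>) + C"
        unfolding C_def by linarith
    qed
    finally show "(\<integral>\<^sup>+x. (\<integral>\<^sup>+y. ?D x y \<partial>lborel) \<partial>lborel) \<le> ennreal (gamma_const s n * ln (R / \<epsilon>) + C)" .
  qed
qed

section \<open>Smooth Moser functions\<close>

text \<open>Differentiating \<open>exp (- (1 / t))\<close> produces powers of \<open>1 / t\<close>;
  including them makes the family closed under differentiation up to linear combinations.\<close>

definition flat_exp :: "nat \<Rightarrow> real \<Rightarrow> real" where
  "flat_exp m t = (if 0 < t then (1 / t) ^ m * exp (- (1 / t)) else 0)"

lemma flat_exp_tendsto_0: "(flat_exp m \<longlongrightarrow> 0) (at 0)"
proof -
  have "((\<lambda>t. (inverse t) ^ m / exp (inverse t)) \<longlongrightarrow> 0) (at_right (0::real))"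
    by (rule filterlim_compose[OF tendsto_power_div_exp_0 filterlim_inverse_at_top_right])
  then have "(flat_exp m \<longlongrightarrow> 0) (at_right 0)"
    by (rule Lim_transform_eventually)
       (auto simp: eventually_at_right_field flat_exp_def exp_minus divide_inverse intro!: exI[of _ 1])
  moreover have "(flat_exp m \<longlongrightarrow> 0) (at_left 0)"
    by (rule Lim_transform_eventually[OF tendsto_const])
       (auto simp: eventually_at_left_field flat_exp_def intro!: exI[of _ "-1"])
  ultimately show ?thesis by (intro filterlim_split_at)
qed

lemma has_real_derivative_flat_exp:
  "(flat_exp m has_real_derivative flat_exp (m + 2) t - real m * flat_exp (m + 1) t) (at t)"
proof -
  consider "0 < t" | "t < 0" | "t = 0" by linarith
  then show ?thesis
  proof cases
    case 1
    have "((\<lambda>t. (1 / t) ^ m * exp (- (1 / t))) has_real_derivative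
        real m * (1 / t) ^ (m - 1) * (- (1 / t\<^sup>2)) * exp (- (1 / t)) + (1 / t) ^ m * (exp (- (1 / t)) * (1 / t\<^sup>2))) (at t)"
      using 1 by (auto intro!: derivative_eq_intros simp: power2_eq_square)
    also have "real m * (1 / t) ^ (m - 1) * (- (1 / t\<^sup>2)) * exp (- (1 / t)) + (1 / t) ^ m * (exp (- (1 / t)) * (1 / t\<^sup>2))
        = flat_exp (m + 2) t - real m * flat_exp (m + 1) t"
      using 1 by (cases m) (simp_all add: flat_exp_def power2_eq_square field_simps)
    finally show ?thesis
      by (rule has_field_derivative_transform_within_open[of _ _ _ "{0<..}"])
         (use 1 in \<open>auto simp: flat_exp_def\<close>)
  next
    case 2
    have "((\<lambda>t. 0) has_real_derivative 0) (at t)" by simp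
    then have "(flat_exp m has_real_derivative 0) (at t)"
      by (rule has_field_derivative_transform_within_open[of _ _ _ "{..<0}"])
         (use 2 in \<open>auto simp: flat_exp_def\<close>)
    then show ?thesis using 2 by (simp add: flat_exp_def)
  next
    case 3
    \<comment> \<open>At 0 the difference quotient of \<open>flat_exp m\<close> is
      \<open>flat_exp (m + 1)\<close> itself.\<close>
    have "(flat_exp (m + 1) \<longlongrightarrow> 0) (at 0)" by (rule flat_exp_tendsto_0)
    then have "((\<lambda>h. (flat_exp m (0 + h) - flat_exp m 0) / h) \<longlongrightarrow> 0) (at 0)"
      by (rule Lim_transform_eventually) (auto simp: flat_exp_def eventually_at_filter)
    then show ?thesis using 3 by (simp add: DERIV_def flat_exp_def)
  qed
qed

text \<open>Smooth and supported on the positive reals, this map has derivative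
  \<open>exp (- 1 / t) * (1 + 1 / t) \<le> 1\<close> and loses at most \<open>1\<close> against the identity; hence truncating a
  function with it neither increases differences nor changes asymptotics.\<close>

definition soft_positive_part :: "real \<Rightarrow> real" where
  "soft_positive_part t = t * flat_exp 0 t"

lemma soft_positive_part_nonpos: "t \<le> 0 \<Longrightarrow> soft_positive_part t = 0"
  by (simp add: soft_positive_part_def flat_exp_def)

lemma soft_positive_part_nonneg: "0 \<le> soft_positive_part t"
  by (simp add: soft_positive_part_def flat_exp_def)

lemma soft_positive_part_le: "0 \<le> t \<Longrightarrow> soft_positive_part t \<le> t"
  by (simp add: soft_positive_part_def flat_exp_def mult_left_le)

lemma soft_positive_part_ge: "t - 1 \<le> soft_positive_part t"
proof (cases "0 < t")
  case True
  have "t * (1 - 1 / t) \<le> t * exp (- (1 / t))"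
    using exp_ge_add_one_self[of "- (1 / t)"] True by (intro mult_left_mono) auto
  then show ?thesis using True by (simp add: soft_positive_part_def flat_exp_def right_diff_distrib)
qed (simp add: soft_positive_part_nonpos)

lemma soft_positive_part_lipschitz: "\<bar>soft_positive_part a - soft_positive_part b\<bar> \<le> \<bar>a - b\<bar>"
proof -
  have deriv: "(soft_positive_part has_real_derivative flat_exp 0 t + t * flat_exp 2 t) (at t)" for t
    unfolding soft_positive_part_def
    using DERIV_mult[OF DERIV_ident has_real_derivative_flat_exp[of 0 t]] by (simp add: add.commute mult.commute numeral_2_eq_2)
  have "\<bar>flat_exp 0 t + t * flat_exp 2 t\<bar> \<le> 1" for t
  proof (cases "0 < t")
    case True
    have "(1 + 1 / t) * exp (- (1 / t)) \<le> exp (1 / t) * exp (- (1 / t))"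
      by (intro mult_right_mono exp_ge_add_one_self) auto
    then have "(1 + 1 / t) * exp (- (1 / t)) \<le> 1" by (simp add: mult_exp_exp)
    moreover have "flat_exp 0 t + t * flat_exp 2 t = (1 + 1 / t) * exp (- (1 / t))"
      using True by (simp add: flat_exp_def power2_eq_square algebra_simps)
    moreover have "0 \<le> (1 + 1 / t) * exp (- (1 / t))" using True by simp
    ultimately show ?thesis by linarith
  qed (simp add: flat_exp_def)
  then have "norm (soft_positive_part a - soft_positive_part b) \<le> 1 * norm (a - b)"
    by (intro field_differentiable_bound[of UNIV]) (auto intro: deriv)
  then show ?thesis by simp
qed

text \<open>A smoothing of \<open>ln (R / r)\<close>, with \<open>r\<close> replaced by the square
  root of \<open>r\<^sup>2 + \<epsilon>\<^sup>2\<close>. Squares inside the logarithm keep it smooth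
  at the centre, where its value is \<open>ln (R / \<epsilon>)\<close>.\<close>

definition moser_log :: "real \<Rightarrow> real \<Rightarrow> real \<Rightarrow> real" where
  "moser_log \<epsilon> R r = ln (R\<^sup>2 / (r\<^sup>2 + \<epsilon>\<^sup>2)) / 2"

text \<open>A class of functions that is closed under directional derivatives, so that all of its
  members are smooth.\<close>

inductive moser_algebra :: "real ^ 'n \<Rightarrow> real \<Rightarrow> real \<Rightarrow> (real ^ 'n \<Rightarrow> real) \<Rightarrow> bool"
  for c \<epsilon> R where
  const: "moser_algebra c \<epsilon> R (\<lambda>x. a)"
| inner: "moser_algebra c \<epsilon> R (\<lambda>x. x \<bullet> v)"
| inverse: "moser_algebra c \<epsilon> R (\<lambda>x. 1 / ((norm (x - c))\<^sup>2 + \<epsilon>\<^sup>2))"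
| log: "moser_algebra c \<epsilon> R (\<lambda>x. moser_log \<epsilon> R (norm (x - c)))"
| flat: "moser_algebra c \<epsilon> R (\<lambda>x. flat_exp m (moser_log \<epsilon> R (norm (x - c))))"
| add: "moser_algebra c \<epsilon> R f \<Longrightarrow> moser_algebra c \<epsilon> R g \<Longrightarrow> moser_algebra c \<epsilon> R (\<lambda>x. f x + g x)"
| mult: "moser_algebra c \<epsilon> R f \<Longrightarrow> moser_algebra c \<epsilon> R g \<Longrightarrow> moser_algebra c \<epsilon> R (\<lambda>x. f x * g x)"

text \<open>The derivative is spelt as a sum with the constant \<open>- (c \<bullet> v)\<close>, the
  shape that the introduction rules of \<open>moser_algebra\<close> match syntactically. Later
  derivatives are written in the same subtraction-free style.\<close>

lemma has_derivative_norm_diff_square: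
  fixes x c :: "real ^ 'n"
  shows "((\<lambda>x. (norm (x - c))\<^sup>2 + \<epsilon>\<^sup>2) has_derivative (\<lambda>v. 2 * (x \<bullet> v + (- (c \<bullet> v))))) (at x)"
  unfolding power2_norm_eq_inner
  by (auto intro!: derivative_eq_intros simp: inner_commute inner_diff_left inner_diff_right algebra_simps)

lemma has_derivative_moser_log:
  fixes x c :: "real ^ 'n"
  assumes "0 < \<epsilon>" "0 < R"
  shows "((\<lambda>x. moser_log \<epsilon> R (norm (x - c))) has_derivative
    (\<lambda>v. (- 1) * ((x \<bullet> v + (- (c \<bullet> v))) * (1 / ((norm (x - c))\<^sup>2 + \<epsilon>\<^sup>2))))) (at x)"
proof -
  let ?s = "(norm (x - c))\<^sup>2 + \<epsilon>\<^sup>2"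
  have s: "0 < ?s" using assms by (simp add: add_nonneg_pos)
  have "((\<lambda>s. ln (K / s) / 2) has_real_derivative (- 1 / (2 * t))) (at t)" if "0 < K" "0 < t" for K t :: real
    using that by (auto intro!: derivative_eq_intros simp: field_simps)
  from this[OF _ s, of "R\<^sup>2"] assms
  have "((\<lambda>s. ln (R\<^sup>2 / s) / 2) has_real_derivative (- 1 / (2 * ?s))) (at ?s)" by simp
  note d = DERIV_compose_FDERIV[OF this has_derivative_norm_diff_square]
  have aux: "2 * z * (- 1 / (2 * t)) = (- 1) * (z * (1 / t))" for z t :: real by simp
  show ?thesis unfolding moser_log_def by (rule has_derivative_eq_rhs[OF d]) (rule ext, rule aux)
qed

lemma moser_algebra_has_derivative:
  assumes "0 < \<epsilon>" "0 < R" "moser_algebra c \<epsilon> R g"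
  shows "\<exists>g'. (\<forall>x. (g has_derivative g' x) (at x)) \<and> (\<forall>v. moser_algebra c \<epsilon> R (\<lambda>x. g' x v))"
  using assms(3)
proof induction
  case (const a)
  show ?case
    by (intro exI[of _ "\<lambda>x v. 0"] conjI allI moser_algebra.const) simp
next
  case (inner w)
  show ?case
    by (intro exI[of _ "\<lambda>x v. v \<bullet> w"] conjI allI moser_algebra.const) (auto intro!: derivative_eq_intros)
next
  case inverse
  let ?q = "\<lambda>x. 1 / ((norm (x - c))\<^sup>2 + \<epsilon>\<^sup>2)"
  have "(?q has_derivative (\<lambda>v. (- 2) * ((x \<bullet> v + (- (c \<bullet> v))) * (?q x * ?q x)))) (at x)" for x
  proof -
    let ?s = "(norm (x - c))\<^sup>2 + \<epsilon>\<^sup>2"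
    have s: "0 < ?s" using assms by (simp add: add_nonneg_pos)
    have "((\<lambda>s. 1 / s) has_real_derivative (- 1 / (?s * ?s))) (at ?s)"
      using s by (auto intro!: derivative_eq_intros)
    note d = DERIV_compose_FDERIV[OF this has_derivative_norm_diff_square]
    have aux: "2 * z * (- 1 / (t * t)) = (- 2) * (z * (1 / t * (1 / t)))" for z t :: real by simp
    show ?thesis by (rule has_derivative_eq_rhs[OF d]) (rule ext, rule aux)
  qed
  moreover have "moser_algebra c \<epsilon> R (\<lambda>x. (- 2) * ((x \<bullet> v + (- (c \<bullet> v))) * (?q x * ?q x)))" for v
    by (intro moser_algebra.intros)
  ultimately show ?case
    by (intro exI[of _ "\<lambda>x v. (- 2) * ((x \<bullet> v + (- (c \<bullet> v))) * (?q x * ?q x))"]) blast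
next
  case log
  let ?D = "\<lambda>x v. (- 1) * ((x \<bullet> v + (- (c \<bullet> v))) * (1 / ((norm (x - c))\<^sup>2 + \<epsilon>\<^sup>2)))"
  have "moser_algebra c \<epsilon> R (\<lambda>x. ?D x v)" for v
    by (intro moser_algebra.intros)
  then show ?case
    by (intro exI[of _ ?D] conjI allI has_derivative_moser_log[OF assms(1,2)])
next
  case (flat m)
  let ?w = "\<lambda>x. moser_log \<epsilon> R (norm (x - c))"
  let ?D = "\<lambda>x v. (- 1) * ((x \<bullet> v + (- (c \<bullet> v))) * (1 / ((norm (x - c))\<^sup>2 + \<epsilon>\<^sup>2))) *
        (flat_exp (m + 2) (?w x) + (- real m) * flat_exp (m + 1) (?w x))"
  have "((\<lambda>x. flat_exp m (?w x)) has_derivative ?D x) (at x)" for x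
  proof -
    have aux: "z * (a - b * e) = z * (a + (- b) * e)" for z a b e :: real by simp
    show ?thesis
      by (rule has_derivative_eq_rhs[OF DERIV_compose_FDERIV[OF has_real_derivative_flat_exp
          has_derivative_moser_log[OF assms(1,2)]]]) (rule ext, rule aux)
  qed
  moreover have "moser_algebra c \<epsilon> R (\<lambda>x. ?D x v)" for v
    by (intro moser_algebra.intros)
  ultimately show ?case by (intro exI[of _ ?D]) blast
next
  case (add f g)
  then obtain f' g' where "\<And>x. (f has_derivative f' x) (at x)" "\<And>v. moser_algebra c \<epsilon> R (\<lambda>x. f' x v)"
    "\<And>x. (g has_derivative g' x) (at x)" "\<And>v. moser_algebra c \<epsilon> R (\<lambda>x. g' x v)" by blast
  then show ?case
    by (intro exI[of _ "\<lambda>x v. f' x v + g' x v"] conjI allI moser_algebra.add has_derivative_add) blast+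
next
  case (mult f g)
  then obtain f' g' where "\<And>x. (f has_derivative f' x) (at x)" "\<And>v. moser_algebra c \<epsilon> R (\<lambda>x. f' x v)"
    "\<And>x. (g has_derivative g' x) (at x)" "\<And>v. moser_algebra c \<epsilon> R (\<lambda>x. g' x v)" by blast
  then show ?case using mult.hyps
    by (intro exI[of _ "\<lambda>x v. f x * g' x v + f' x v * g x"] conjI allI moser_algebra.add moser_algebra.mult
        has_derivative_mult) blast+
qed

lemma C_diff_moser_algebra:
  assumes "0 < \<epsilon>" "0 < R"
  shows "moser_algebra c \<epsilon> R g \<Longrightarrow> C_diff k g"
proof (induction k arbitrary: g)
  case 0
  then obtain g' where "\<And>x. (g has_derivative g' x) (at x)"
    using moser_algebra_has_derivative[OF assms] by blast
  then show ?case
    by (auto intro!: continuous_at_imp_continuous_on has_derivative_continuous)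
next
  case (Suc k)
  then obtain g' where g': "\<And>x. (g has_derivative g' x) (at x)" "\<And>v. moser_algebra c \<epsilon> R (\<lambda>x. g' x v)"
    using moser_algebra_has_derivative[OF assms] by blast
  have "frechet_derivative g (at x) = g' x" for x
    using frechet_derivative_at[OF g'(1)] by simp
  then show ?case using g' Suc.IH by (auto simp: differentiable_def)
qed

definition moser_profile :: "real \<Rightarrow> real \<Rightarrow> real \<Rightarrow> real" where
  "moser_profile \<epsilon> R r = soft_positive_part (moser_log \<epsilon> R r)"

lemma moser_algebra_profile: "moser_algebra c \<epsilon> R (\<lambda>x. a * moser_profile \<epsilon> R (norm (x - c)))"
  unfolding moser_profile_def soft_positive_part_def by (intro moser_algebra.intros)

section \<open>Size and oscillation of the truncated logarithms\<close>

lemma moser_log_nonpos: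
  assumes "0 < \<epsilon>" "0 < R" "R \<le> r"
  shows "moser_log \<epsilon> R r \<le> 0"
proof -
  have "R\<^sup>2 \<le> r\<^sup>2" using assms by (intro power_mono) auto
  then have "R\<^sup>2 \<le> r\<^sup>2 + \<epsilon>\<^sup>2" by (simp add: add_increasing2)
  moreover have "0 < r\<^sup>2 + \<epsilon>\<^sup>2" using assms by (simp add: add_nonneg_pos)
  ultimately have "R\<^sup>2 / (r\<^sup>2 + \<epsilon>\<^sup>2) \<le> 1" by (simp add: divide_le_eq)
  then show ?thesis using assms \<open>0 < r\<^sup>2 + \<epsilon>\<^sup>2\<close> by (simp add: moser_log_def)
qed

lemma moser_profile_eq_0: "0 < \<epsilon> \<Longrightarrow> 0 < R \<Longrightarrow> R \<le> r \<Longrightarrow> moser_profile \<epsilon> R r = 0"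
  unfolding moser_profile_def by (intro soft_positive_part_nonpos moser_log_nonpos)

lemma moser_profile_nonneg: "0 \<le> moser_profile \<epsilon> R r"
  by (simp add: moser_profile_def soft_positive_part_nonneg)

lemma moser_profile_le:
  assumes "0 < \<epsilon>" "0 < R" "0 < r" "r < R"
  shows "moser_profile \<epsilon> R r \<le> ln (R / r)"
proof -
  have "R\<^sup>2 / (r\<^sup>2 + \<epsilon>\<^sup>2) \<le> R\<^sup>2 / r\<^sup>2"
    using assms by (intro divide_left_mono) (auto simp: add_nonneg_pos)
  then have "ln (R\<^sup>2 / (r\<^sup>2 + \<epsilon>\<^sup>2)) \<le> ln ((R / r)\<^sup>2)"
    using assms by (intro ln_mono) (auto simp: add_nonneg_pos power_divide)
  then have "moser_log \<epsilon> R r \<le> ln (R / r)" using assms by (simp add: moser_log_def ln_realpow)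
  moreover have "0 \<le> ln (R / r)" using assms by simp
  ultimately show ?thesis unfolding moser_profile_def
    by (cases "0 \<le> moser_log \<epsilon> R r") (auto simp: soft_positive_part_nonpos dest: soft_positive_part_le)
qed

text \<open>Of the loss 2, one unit is due to the soft truncation; the other covers
  \<open>ln 2 / 2\<close>, which comes from
  \<open>r\<^sup>2 + \<epsilon>\<^sup>2 \<le> 2 * \<epsilon>\<^sup>2\<close>.\<close>

lemma moser_profile_ge:
  assumes "0 < \<epsilon>" "0 < R" "0 \<le> r" "r \<le> \<epsilon>"
  shows "ln (R / \<epsilon>) - 2 \<le> moser_profile \<epsilon> R r"
proof -
  have "r\<^sup>2 \<le> \<epsilon>\<^sup>2" using assms by (intro power_mono) auto
  then have "R\<^sup>2 / (2 * \<epsilon>\<^sup>2) \<le> R\<^sup>2 / (r\<^sup>2 + \<epsilon>\<^sup>2)"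
    using assms by (intro divide_left_mono) (auto simp: add_nonneg_pos)
  then have "ln (R\<^sup>2 / (2 * \<epsilon>\<^sup>2)) \<le> ln (R\<^sup>2 / (r\<^sup>2 + \<epsilon>\<^sup>2))"
    using assms by (intro ln_mono) (auto simp: add_nonneg_pos)
  moreover have "ln (R\<^sup>2 / (2 * \<epsilon>\<^sup>2)) = 2 * ln (R / \<epsilon>) - ln 2"
    using assms by (simp add: ln_div ln_mult ln_realpow)
  moreover have "ln 2 \<le> (1::real)" using ln_le_minus_one[of 2] by simp
  ultimately have "ln (R / \<epsilon>) - 1 \<le> moser_log \<epsilon> R r" by (simp add: moser_log_def)
  then show ?thesis
    using soft_positive_part_ge[of "moser_log \<epsilon> R r"] by (simp add: moser_profile_def)
qed

text \<open>The difference is half of \<open>ln (?b / ?a)\<close>. Bounding \<open>?b / ?a\<close>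
  by \<open>(\<rho> / r)\<^sup>2\<close> gives the factor 1. Bounding the logarithm by
  \<open>?b / ?a - 1\<close> and \<open>?a\<close> from below by \<open>\<epsilon>\<^sup>2\<close>
  gives the quadratic gain, which reflects that the smoothed logarithm is flat near its
  centre.\<close>

lemma moser_log_diff_le:
  assumes "0 < \<epsilon>" "0 < R" "0 < r" "r \<le> \<rho>"
  shows "\<bar>moser_log \<epsilon> R \<rho> - moser_log \<epsilon> R r\<bar> \<le> ln (\<rho> / r) * min 1 ((\<rho> / \<epsilon>)\<^sup>2)"
proof -
  let ?a = "r\<^sup>2 + \<epsilon>\<^sup>2" and ?b = "\<rho>\<^sup>2 + \<epsilon>\<^sup>2"
  have a: "0 < ?a" "0 < ?b" using assms by (simp_all add: add_nonneg_pos)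
  have "r\<^sup>2 \<le> \<rho>\<^sup>2" using assms by (intro power_mono) auto
  then have ab: "?a \<le> ?b" by simp
  have d: "\<bar>moser_log \<epsilon> R \<rho> - moser_log \<epsilon> R r\<bar> = ln (?b / ?a) / 2"
  proof -
    have "ln ?a \<le> ln ?b" using a ab by (intro ln_mono) auto
    moreover have "ln (R\<^sup>2 / ?a) = ln (R\<^sup>2) - ln ?a" "ln (R\<^sup>2 / ?b) = ln (R\<^sup>2) - ln ?b"
      "ln (?b / ?a) = ln ?b - ln ?a"
      using a assms by (simp_all add: ln_div)
    ultimately show ?thesis unfolding moser_log_def by (simp add: field_simps)
  qed
  have "?b / ?a \<le> (\<rho> / r)\<^sup>2"
    using a assms \<open>r\<^sup>2 \<le> \<rho>\<^sup>2\<close> by (simp add: power_divide divide_simps algebra_simps mult_right_mono)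
  then have "ln (?b / ?a) \<le> ln ((\<rho> / r)\<^sup>2)" using a by (intro ln_mono) auto
  then have 1: "ln (?b / ?a) / 2 \<le> ln (\<rho> / r)" using assms by (simp add: ln_realpow)
  have "ln (?b / ?a) \<le> ?b / ?a - 1" using a by (intro ln_le_minus_one) auto
  also have "?b / ?a - 1 = (?b - ?a) / ?a"
  proof -
    have "z / t - 1 = (z - t) / t" if "0 < t" for z t :: real using that by (simp add: field_simps)
    then show ?thesis using a(1) .
  qed
  also have "?b - ?a = \<rho>\<^sup>2 - r\<^sup>2" by simp
  also have "(\<rho>\<^sup>2 - r\<^sup>2) / ?a \<le> (\<rho>\<^sup>2 - r\<^sup>2) / \<epsilon>\<^sup>2"
    using \<open>r\<^sup>2 \<le> \<rho>\<^sup>2\<close> a assms by (intro divide_left_mono) auto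
  finally have 2: "ln (?b / ?a) \<le> (\<rho>\<^sup>2 - r\<^sup>2) / \<epsilon>\<^sup>2" .
  \<comment> \<open>This leads from the difference of squares back to the logarithm, as
    \<open>\<rho>\<^sup>2 - r\<^sup>2 \<le> 2 * \<rho> * (\<rho> - r)\<close>.\<close>
  have "1 - r / \<rho> \<le> ln (\<rho> / r)"
    using ln_le_minus_one[of "r / \<rho>"] assms by (simp add: ln_div)
  then have "(1 - r / \<rho>) * (2 * \<rho>\<^sup>2) \<le> ln (\<rho> / r) * (2 * \<rho>\<^sup>2)" by (intro mult_right_mono) auto
  moreover have "(1 - r / \<rho>) * (2 * \<rho>\<^sup>2) = 2 * \<rho>\<^sup>2 - 2 * r * \<rho>" using assms by (simp add: field_simps power2_eq_square)
  moreover have "2 * r * \<rho> \<le> r\<^sup>2 + \<rho>\<^sup>2" using sum_squares_bound[of r \<rho>] by simp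
  ultimately have "\<rho>\<^sup>2 - r\<^sup>2 \<le> ln (\<rho> / r) * (2 * \<rho>\<^sup>2)" by (smt (verit))
  then have "(\<rho>\<^sup>2 - r\<^sup>2) / \<epsilon>\<^sup>2 \<le> ln (\<rho> / r) * (2 * \<rho>\<^sup>2) / \<epsilon>\<^sup>2" by (intro divide_right_mono) auto
  moreover have "ln (\<rho> / r) * (2 * \<rho>\<^sup>2) / \<epsilon>\<^sup>2 = 2 * (ln (\<rho> / r) * (\<rho> / \<epsilon>)\<^sup>2)" by (simp add: power_divide)
  ultimately have "ln (?b / ?a) / 2 \<le> ln (\<rho> / r) * (\<rho> / \<epsilon>)\<^sup>2" using 2 by linarith
  then show ?thesis using 1 unfolding d by (simp add: min_def)
qed

lemma moser_profile_diff_le: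
  assumes "0 < \<epsilon>" "0 < R" "0 < r" "0 < \<rho>"
  shows "\<bar>moser_profile \<epsilon> R \<rho> - moser_profile \<epsilon> R r\<bar> \<le> \<bar>ln (\<rho> / r)\<bar> * min 1 ((max r \<rho> / \<epsilon>)\<^sup>2)"
proof -
  have "\<bar>moser_profile \<epsilon> R \<rho> - moser_profile \<epsilon> R r\<bar> \<le> \<bar>moser_log \<epsilon> R \<rho> - moser_log \<epsilon> R r\<bar>"
    unfolding moser_profile_def by (rule soft_positive_part_lipschitz)
  also have "\<dots> \<le> \<bar>ln (\<rho> / r)\<bar> * min 1 ((max r \<rho> / \<epsilon>)\<^sup>2)"
  proof (cases "r \<le> \<rho>")
    case True
    moreover have "0 \<le> ln (\<rho> / r)" using True assms by simp
    ultimately show ?thesis using moser_log_diff_le[OF assms(1-3) True] by (simp add: max_def)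
  next
    case False
    then have "\<bar>ln (\<rho> / r)\<bar> = ln (r / \<rho>)" using assms by (simp add: ln_div)
    then show ?thesis using False moser_log_diff_le[of \<epsilon> R \<rho> r] assms
      by (simp add: max_def abs_minus_commute)
  qed
  finally show ?thesis .
qed

text \<open>These are the hypotheses of \<open>gagliardo_log_radial_le\<close>. For the second
  bound, the \<open>p\<close>-th power of \<open>min 1 (m\<^sup>2)\<close> is at most
  \<open>m powr (1 / 2)\<close> because \<open>2 * p > 1 / 2\<close>, and
  \<open>m \<le> (r / \<epsilon>) * exp \<tau>\<close> trades the larger radius for
  \<open>r\<close>. For the third, both values vanish if \<open>R \<le> \<rho>\<close>; otherwise
  \<open>r \<le> R * exp \<tau>\<close>, so the two extra factors have product at least 1.\<close>

lemma moser_profile_diff_powr_le: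
  assumes "0 < \<epsilon>" "0 < R" "0 < r" "0 < \<rho>" "1 < p"
  defines "\<tau> \<equiv> \<bar>ln (\<rho> / r)\<bar>"
  shows "\<bar>moser_profile \<epsilon> R \<rho> - moser_profile \<epsilon> R r\<bar> powr p \<le> \<tau> powr p"
    and "\<bar>moser_profile \<epsilon> R \<rho> - moser_profile \<epsilon> R r\<bar> powr p \<le> \<tau> powr p * exp (\<tau> / 2) * (r / \<epsilon>) powr (1 / 2)"
    and "R < r \<Longrightarrow> \<bar>moser_profile \<epsilon> R \<rho> - moser_profile \<epsilon> R r\<bar> powr p \<le> \<tau> powr p * exp (\<tau> / 2) * (R / r) powr (1 / 2)"
proof -
  define \<Delta> where "\<Delta> = \<bar>moser_profile \<epsilon> R \<rho> - moser_profile \<epsilon> R r\<bar>"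
  define m where "m = max r \<rho> / \<epsilon>"
  have m: "0 < m" using assms by (auto simp: m_def)
  have \<tau>: "0 \<le> \<tau>" by (simp add: \<tau>_def)
  have \<Delta>: "\<Delta> \<le> \<tau> * min 1 (m\<^sup>2)" "0 \<le> \<Delta>"
    unfolding \<Delta>_def \<tau>_def m_def by (rule moser_profile_diff_le[OF assms(1-4)]) simp
  have "\<tau> * min 1 (m\<^sup>2) \<le> \<tau>" using \<tau> by (simp add: mult_left_le)
  then have 1: "\<Delta> powr p \<le> \<tau> powr p" using \<Delta> assms by (intro powr_mono2) auto
  then show "\<bar>moser_profile \<epsilon> R \<rho> - moser_profile \<epsilon> R r\<bar> powr p \<le> \<tau> powr p" by (simp add: \<Delta>_def)
  have exp_pos: "exp (ln (\<rho> / r)) = \<rho> / r" using assms by simp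
  have r_exp: "r \<le> r * exp \<tau>" "\<rho> \<le> r * exp \<tau>" "r \<le> \<rho> * exp \<tau>"
  proof -
    show "r \<le> r * exp \<tau>" using \<tau> assms by simp
    have "exp (ln (\<rho> / r)) \<le> exp \<tau>" unfolding \<tau>_def by simp
    then have "\<rho> / r \<le> exp \<tau>" by (simp only: exp_pos)
    then show "\<rho> \<le> r * exp \<tau>" using assms by (simp add: divide_le_eq mult.commute)
    have "exp (- ln (\<rho> / r)) \<le> exp \<tau>" unfolding \<tau>_def by simp
    then have "r / \<rho> \<le> exp \<tau>" using assms by (simp add: exp_minus)
    then show "r \<le> \<rho> * exp \<tau>" using assms by (simp add: divide_le_eq mult.commute)
  qed
  have sqrt_exp: "exp \<tau> powr (1 / 2) = exp (\<tau> / 2)" by (simp add: powr_def)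
  have "\<Delta> powr p \<le> \<tau> powr p * m powr (1 / 2)"
  proof (cases "1 \<le> m")
    case True
    then have "1 \<le> m powr (1 / 2)" by (simp add: ge_one_powr_ge_zero)
    then have "\<tau> powr p * 1 \<le> \<tau> powr p * m powr (1 / 2)" by (intro mult_left_mono) auto
    then show ?thesis using 1 by simp
  next
    case False
    have "\<tau> * min 1 (m\<^sup>2) \<le> \<tau> * m\<^sup>2" using \<tau> by (intro mult_left_mono) auto
    then have "\<Delta> powr p \<le> (\<tau> * m\<^sup>2) powr p" using \<Delta> assms by (intro powr_mono2) auto
    also have "\<dots> = \<tau> powr p * m powr (2 * p)"
      using \<tau> m by (simp add: powr_mult powr_powr flip: powr_numeral)
    also have "\<dots> \<le> \<tau> powr p * m powr (1 / 2)"
      using False m assms by (intro mult_left_mono powr_mono') auto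
    finally show ?thesis .
  qed
  also have "\<dots> \<le> \<tau> powr p * ((r / \<epsilon>) * exp \<tau>) powr (1 / 2)"
    using m r_exp assms by (intro mult_left_mono powr_mono2) (auto simp: m_def divide_right_mono)
  also have "\<dots> = \<tau> powr p * exp (\<tau> / 2) * (r / \<epsilon>) powr (1 / 2)"
    using assms(1-5) by (subst powr_mult) (auto simp: sqrt_exp)
  finally show "\<bar>moser_profile \<epsilon> R \<rho> - moser_profile \<epsilon> R r\<bar> powr p \<le> \<tau> powr p * exp (\<tau> / 2) * (r / \<epsilon>) powr (1 / 2)"
    by (simp add: \<Delta>_def)
  assume r: "R < r"
  show "\<bar>moser_profile \<epsilon> R \<rho> - moser_profile \<epsilon> R r\<bar> powr p \<le> \<tau> powr p * exp (\<tau> / 2) * (R / r) powr (1 / 2)"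
  proof (cases "R \<le> \<rho>")
    case True
    then show ?thesis using r assms by (simp add: moser_profile_eq_0)
  next
    case False
    have "r \<le> R * exp \<tau>" using r_exp(3) False by (meson exp_ge_zero less_imp_le mult_right_mono not_le order_trans)
    then have "1 \<le> (R / r) * exp \<tau>" using assms by (simp add: field_simps)
    then have "1 \<le> ((R / r) * exp \<tau>) powr (1 / 2)" by (rule ge_one_powr_ge_zero) simp
    also have "\<dots> = exp (\<tau> / 2) * (R / r) powr (1 / 2)"
      using assms(1-5) by (subst powr_mult) (auto simp: sqrt_exp)
    finally have "\<tau> powr p * 1 \<le> \<tau> powr p * (exp (\<tau> / 2) * (R / r) powr (1 / 2))"
      by (intro mult_left_mono) auto
    then show ?thesis using 1 by (simp add: \<Delta>_def mult.assoc)
  qed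
qed

section \<open>Concentration and blow-up\<close>

text \<open>The norms are defined with a \<open>p\<close>-th root and the constraint raises them to
  the power \<open>p\<close> again; this returns the bare integrals, infinite values
  included.\<close>

lemma epowr_inverse:
  assumes "0 < p"
  shows "epowr (epowr X (1 / p)) p = X"
  using assms by (cases X) (auto simp: epowr_def powr_powr infinity_ennreal_def)

lemma epowr_less_top_iff: "epowr X a < \<infinity> \<longleftrightarrow> X < \<infinity>"
  by (cases X) (auto simp: epowr_def infinity_ennreal_def)

lemma epowr_le_1:
  assumes "0 < a" "X \<le> 1"
  shows "epowr X a \<le> 1"
proof -
  obtain r where r: "X = ennreal r" "0 \<le> r" "r \<le> 1"
    using assms by (cases X) (auto simp: top_unique)
  then have "r powr a \<le> 1" using assms by (simp add: powr_le1)
  then show ?thesis using r by (simp add: epowr_def)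
qed

lemma nn_integral_lborel_shift:
  fixes f :: "'a::euclidean_space \<Rightarrow> ennreal"
  assumes [measurable]: "f \<in> borel_measurable borel"
  shows "(\<integral>\<^sup>+x. f (x - c) \<partial>lborel) = (\<integral>\<^sup>+x. f x \<partial>lborel)"
proof -
  have "(\<integral>\<^sup>+x. f x \<partial>lborel) = (\<integral>\<^sup>+x. f x \<partial>distr lborel borel ((+) (- c)))"
    by (simp add: lborel_distr_plus)
  also have "\<dots> = (\<integral>\<^sup>+x. f (- c + x) \<partial>lborel)"
    by (rule nn_integral_distr) auto
  finally show ?thesis by simp
qed

text \<open>With \<open>x = (2 * \<gamma> + D) / A\<close> the quotient is \<open>1 - x\<close>, and
  the second condition on \<open>L\<close> says \<open>x \<le> 1 / 2\<close>. Then
  \<open>ln (1 - x) \<ge> - (2 * x)\<close>, so the power is at least \<open>1 - 2 * a * x\<close>.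
  As \<open>(L - 2) * x\<close> is at most \<open>(2 * \<gamma> + D) / \<gamma>\<close>, the total
  loss does not depend on \<open>L\<close>.\<close>

lemma growth_estimate:
  fixes \<gamma> D a L :: real
  assumes \<gamma>: "0 < \<gamma>" and D: "0 \<le> D" and a: "0 < a" and L: "2 \<le> L" "2 * (2 * \<gamma> + D) \<le> \<gamma> * L + D"
  shows "L - 2 - 2 * a * (2 * \<gamma> + D) / \<gamma> \<le> (L - 2) * (\<gamma> * (L - 2) / (\<gamma> * L + D)) powr a"
proof -
  define A where "A = \<gamma> * L + D"
  define x where "x = (2 * \<gamma> + D) / A"
  have A: "0 < A" using assms by (simp add: A_def add_pos_nonneg)
  have x: "0 \<le> x" "x \<le> 1 / 2" using assms A by (auto simp: x_def A_def[symmetric] divide_le_eq)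
  have e: "\<gamma> * (L - 2) / A = 1 - x"
    using A unfolding x_def by (simp add: field_simps) (simp add: A_def algebra_simps)
  have "- x - 2 * x\<^sup>2 \<le> ln (1 - x)" using x by (rule ln_one_minus_pos_lower_bound)
  moreover have "x\<^sup>2 \<le> x / 2" using x mult_left_mono[of x "1/2" x] by (simp add: power2_eq_square)
  ultimately have ln: "- (2 * x) \<le> ln (1 - x)" by simp
  have "1 - 2 * a * x \<le> 1 + a * ln (1 - x)" using mult_left_mono[OF ln, of a] a by simp
  also have "\<dots> \<le> exp (a * ln (1 - x))" by (rule exp_ge_add_one_self)
  also have "\<dots> = (1 - x) powr a" using x by (simp add: powr_def)
  finally have "(L - 2) * (1 - 2 * a * x) \<le> (L - 2) * (1 - x) powr a"
    using L by (intro mult_left_mono) auto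
  moreover have "(L - 2) * x \<le> (2 * \<gamma> + D) / \<gamma>"
  proof -
    have "\<gamma> * (L - 2) \<le> A" using \<gamma> D by (simp add: A_def algebra_simps)
    then have "(L - 2) / A \<le> 1 / \<gamma>" using A \<gamma> by (simp add: field_simps)
    then have "(2 * \<gamma> + D) * ((L - 2) / A) \<le> (2 * \<gamma> + D) * (1 / \<gamma>)"
      using \<gamma> D by (intro mult_left_mono) auto
    then show ?thesis by (simp add: x_def mult.commute)
  qed
  then have "2 * a * ((L - 2) * x) \<le> 2 * a * ((2 * \<gamma> + D) / \<gamma>)" using a by (intro mult_left_mono) auto
  ultimately show ?thesis unfolding A_def[symmetric] e by (simp add: algebra_simps)
qed

text \<open>With \<open>a = s / (n - s)\<close> one has \<open>n / (n - s) = 1 + a\<close> and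
  \<open>(s / n) * (1 + a) = a\<close>. Hence the normalisation enters as \<open>A powr a\<close>,
  precisely matched by the factor \<open>\<gamma> powr a\<close> of \<open>alpha_star\<close>, and
  the leading term is \<open>n * L\<close>.\<close>

lemma exp_moser_ge:
  fixes \<gamma> D s n L :: real
  assumes \<gamma>: "0 < \<gamma>" and D: "0 \<le> D" and s: "0 < s" "s < n" and L: "2 < L" "2 * (2 * \<gamma> + D) \<le> \<gamma> * L + D"
    and v: "(L - 2) / (\<gamma> * L + D) powr (s / n) \<le> v"
  shows "n * L - n * (2 + 2 * (s / (n - s)) * (2 * \<gamma> + D) / \<gamma>) \<le> n * \<gamma> powr (s / (n - s)) * v powr (n / (n - s))"
proof -
  define A where "A = \<gamma> * L + D"
  define a where "a = s / (n - s)"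
  have A: "0 < A" using assms by (simp add: A_def add_pos_nonneg)
  have a: "0 < a" using s by (simp add: a_def)
  have q: "n / (n - s) = 1 + a" "s * (1 + a) / n = a" using s by (simp_all add: a_def field_simps)
  have "\<gamma> powr a * ((L - 2) / A powr (s / n)) powr (1 + a) = (L - 2) * (\<gamma> * (L - 2) / A) powr a"
  proof -
    have "((L - 2) / A powr (s / n)) powr (1 + a) = (L - 2) powr (1 + a) / A powr a"
      using L A by (simp add: powr_divide powr_powr q)
    also have "(L - 2) powr (1 + a) = (L - 2) * (L - 2) powr a" using L by (simp add: powr_add)
    finally show ?thesis using L A \<gamma> by (simp add: powr_mult powr_divide)
  qed
  also have "\<dots> \<ge> L - 2 - 2 * a * (2 * \<gamma> + D) / \<gamma>"
    unfolding A_def using assms a by (intro growth_estimate) auto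
  finally have "L - 2 - 2 * a * (2 * \<gamma> + D) / \<gamma> \<le> \<gamma> powr a * ((L - 2) / A powr (s / n)) powr (1 + a)" .
  also have "\<dots> \<le> \<gamma> powr a * v powr (1 + a)"
    using v a L A unfolding A_def by (intro mult_left_mono powr_mono2) auto
  finally have "n * (L - 2 - 2 * a * (2 * \<gamma> + D) / \<gamma>) \<le> n * (\<gamma> powr a * v powr (1 + a))"
    using s by (intro mult_left_mono) auto
  then show ?thesis unfolding q(1) a_def[symmetric] by (simp add: algebra_simps)
qed

text \<open>Used with \<open>q = 1 / p < 1\<close>: normalisation divides by less than the first
  power of \<open>L\<close>, so the functions still tend to infinity on the core, as is needed to
  exploit the growth of \<open>f\<close>.\<close>

lemma filterlim_moser_height:
  fixes \<gamma> D q :: real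
  assumes "0 < \<gamma>" "0 \<le> D" "0 < q" "q < 1"
  shows "filterlim (\<lambda>L. (L - 2) / (\<gamma> * L + D) powr q) at_top at_top"
proof (rule filterlim_at_top_mono)
  have "filterlim (\<lambda>L::real. L powr (1 - q)) at_top at_top"
  proof (rule filterlim_cong[THEN iffD1, OF refl refl])
    show "filterlim (\<lambda>L. exp ((1 - q) * ln L)) at_top (at_top :: real filter)"
      using assms
      by (intro filterlim_compose[OF exp_at_top] filterlim_tendsto_pos_mult_at_top[OF tendsto_const _ ln_at_top]) auto
    show "eventually (\<lambda>L::real. exp ((1 - q) * ln L) = L powr (1 - q)) at_top"
      using eventually_gt_at_top[of 0] by eventually_elim (simp add: powr_def)
  qed
  then show "filterlim (\<lambda>L. 1 / (2 * (\<gamma> + D) powr q) * L powr (1 - q)) at_top at_top"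
    using assms by (intro filterlim_tendsto_pos_mult_at_top[OF tendsto_const]) auto
  show "eventually (\<lambda>L. 1 / (2 * (\<gamma> + D) powr q) * L powr (1 - q) \<le> (L - 2) / (\<gamma> * L + D) powr q) at_top"
    using eventually_ge_at_top[of 4]
  proof eventually_elim
    case (elim L)
    have "D * 1 \<le> D * L" using assms elim by (intro mult_left_mono) auto
    then have "\<gamma> * L + D \<le> (\<gamma> + D) * L" by (simp add: algebra_simps)
    moreover have pos: "0 < \<gamma> * L + D" using assms elim by (simp add: add_pos_nonneg)
    ultimately have "(\<gamma> * L + D) powr q \<le> ((\<gamma> + D) * L) powr q" using assms by (intro powr_mono2) auto
    also have "\<dots> = (\<gamma> + D) powr q * L powr q" using assms elim by (intro powr_mult) 
    finally have le: "(\<gamma> * L + D) powr q \<le> (\<gamma> + D) powr q * L powr q" .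
    have "1 / (2 * (\<gamma> + D) powr q) * L powr (1 - q) = (L / 2) / ((\<gamma> + D) powr q * L powr q)"
      using elim by (simp add: powr_diff)
    also have "\<dots> \<le> (L / 2) / (\<gamma> * L + D) powr q"
    proof -
      have "0 < \<gamma> + D" using assms by simp
      then show ?thesis using le pos elim by (intro divide_left_mono mult_pos_pos) auto
    qed
    also have "\<dots> \<le> (L - 2) / (\<gamma> * L + D) powr q" using elim by (intro divide_right_mono) auto
    finally show ?case .
  qed
qed

text \<open>\<open>Psi\<close> differs from the exponential by a polynomial. Losing a factor 2 is
  harmless, since \<open>f\<close> supplies arbitrarily large factors.\<close>

lemma Psi_ge_half_exp: "eventually (\<lambda>x. exp x / 2 \<le> Psi p x) at_top"
proof -
  have "((\<lambda>x. (\<Sum>j<nat \<lceil>p - 1\<rceil>. (x ^ j / exp x) / fact j)) \<longlongrightarrow> (\<Sum>j<nat \<lceil>p - 1\<rceil>. 0 / fact j)) (at_top :: real filter)"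
    by (intro tendsto_sum tendsto_divide tendsto_power_div_exp_0 tendsto_const) auto
  then have "eventually (\<lambda>x. (\<Sum>j<nat \<lceil>p - 1\<rceil>. (x ^ j / exp x) / fact j) < 1 / 2) (at_top :: real filter)"
    by (intro order_tendstoD) auto
  then show ?thesis
  proof eventually_elim
    case (elim x)
    have "(\<Sum>j<nat \<lceil>p - 1\<rceil>. x ^ j / fact j) = exp x * (\<Sum>j<nat \<lceil>p - 1\<rceil>. (x ^ j / exp x) / fact j)"
      by (simp add: sum_distrib_left)
    also have "\<dots> \<le> exp x * (1 / 2)" using elim by (intro mult_left_mono) auto
    finally show ?case by (simp add: Psi_def)
  qed
qed

text \<open>Uniformity in \<open>\<epsilon>\<close> is the point: the profile lies below
  \<open>ln (R / r)\<close> for every \<open>\<epsilon>\<close>, and every power of that logarithm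
  is integrable on the ball.\<close>

lemma moser_profile_Lp_le:
  assumes n: "n = CARD('n)" and p: "0 < p" and R: "0 < R"
  obtains C where "0 \<le> C" and
    "\<And>\<epsilon>. 0 < \<epsilon> \<Longrightarrow> (\<integral>\<^sup>+(x :: real ^ 'n). ennreal (moser_profile \<epsilon> R (norm x) powr p) \<partial>lborel) \<le> ennreal C"
proof -
  \<comment> \<open>With \<open>\<kappa> * p = n - 1 / 2\<close> the bound
    \<open>t powr \<kappa> / \<kappa>\<close> for \<open>ln t\<close> turns the \<open>p\<close>-th
    power into a multiple of the weight in \<open>nn_integral_interior\<close>.\<close>
  define \<kappa> where "\<kappa> = (real n - 1 / 2) / p"
  have n1: "1 \<le> real n" using n by simp
  have \<kappa>: "0 < \<kappa>" "\<kappa> * p = real n - 1 / 2" using n1 p by (simp_all add: \<kappa>_def)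
  define C where "C = (1 / \<kappa>) powr p * R ^ n"
  have C0: "0 \<le> C" using R by (simp add: C_def)
  let ?K = "2 * real CARD('n) * unit_ball_vol (real CARD('n))"
  show thesis
  proof (rule that[of "C * ?K"])
    show "0 \<le> C * ?K" using C0 by simp
    fix \<epsilon> :: real assume \<epsilon>: "0 < \<epsilon>"
    let ?W = "\<lambda>x :: real ^ 'n. ennreal (if norm x < R then (norm x / R) powr (1 / 2) / norm x ^ CARD('n) else 0)"
    have "(\<integral>\<^sup>+(x :: real ^ 'n). ennreal (moser_profile \<epsilon> R (norm x) powr p) \<partial>lborel)
        \<le> (\<integral>\<^sup>+x. ennreal C * ?W x \<partial>lborel)"
    proof (rule nn_integral_mono_AE)
      have "AE x in lborel. x \<noteq> (0 :: real ^ 'n)" by (rule AE_lborel_singleton)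
      then show "AE x :: real ^ 'n in lborel. ennreal (moser_profile \<epsilon> R (norm x) powr p) \<le> ennreal C * ?W x"
      proof eventually_elim
        case (elim x)
        show ?case
        proof (cases "norm x < R")
          case True
          define t where "t = R / norm x"
          have t: "1 \<le> t" "0 < t" using True elim R by (auto simp: t_def)
          have "moser_profile \<epsilon> R (norm x) \<le> ln t"
            unfolding t_def using True elim R \<epsilon> by (intro moser_profile_le) auto
          also have "ln t \<le> t powr \<kappa> / \<kappa>" using t \<kappa> by (intro ln_powr_bound) auto
          finally have "moser_profile \<epsilon> R (norm x) powr p \<le> (1 / \<kappa> * t powr \<kappa>) powr p"
            using p by (intro powr_mono2) (auto simp: moser_profile_nonneg)
          also have "\<dots> = (1 / \<kappa>) powr p * t powr (real n - 1 / 2)"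
            using \<kappa> by (simp add: powr_mult powr_powr powr_divide)
          also have "t powr (real n - 1 / 2) = R ^ n * ((norm x / R) powr (1 / 2) / norm x ^ n)"
            using t elim R by (simp add: powr_diff powr_realpow t_def powr_divide power_divide)
          finally have "moser_profile \<epsilon> R (norm x) powr p \<le> C * ((norm x / R) powr (1 / 2) / norm x ^ n)"
            by (simp add: C_def mult.assoc)
          then have "ennreal (moser_profile \<epsilon> R (norm x) powr p) \<le> ennreal (C * ((norm x / R) powr (1 / 2) / norm x ^ n))"
            by (rule ennreal_leI)
          also have "\<dots> = ennreal C * ?W x"
            using True unfolding n by (simp only: if_True ennreal_mult'[OF C0])
          finally show ?thesis .
        next
          case False
          then show ?thesis using \<epsilon> R by (simp add: moser_profile_eq_0)
        qed
      qed
    qed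
    also have "\<dots> = ennreal C * (\<integral>\<^sup>+x. ?W x \<partial>lborel)"
      by (rule nn_integral_cmult) measurable
    also have "\<dots> \<le> ennreal C * ennreal ?K"
      by (intro mult_left_mono nn_integral_interior R) auto
    also have "\<dots> = ennreal (C * ?K)" using C0 by (intro ennreal_mult[symmetric]) auto
    finally show "(\<integral>\<^sup>+(x :: real ^ 'n). ennreal (moser_profile \<epsilon> R (norm x) powr p) \<partial>lborel) \<le> ennreal (C * ?K)" .
  qed
qed

lemma borel_measurable_moser_profile [measurable]: "moser_profile \<epsilon> R \<in> borel_measurable borel"
  unfolding moser_profile_def[abs_def] soft_positive_part_def moser_log_def flat_exp_def by measurable

text \<open>\<open>C\<close> is fixed before \<open>\<epsilon>\<close>, \<open>R\<close> and
  \<open>c\<close>: translation removes the centre, and the increment bounds involve no further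
  constants.\<close>

lemma nn_integral_gagliardo_moser_profile_le:
  assumes n: "n = CARD('n)" and s: "0 < s" "s < 1" and p: "s * p = real n" "1 < p"
  obtains C where "0 < C" and
    "\<And>\<epsilon> R (c :: real ^ 'n). 0 < \<epsilon> \<Longrightarrow> \<epsilon> \<le> R \<Longrightarrow>
      (\<integral>\<^sup>+y. (\<integral>\<^sup>+x. ennreal (\<bar>moser_profile \<epsilon> R (norm (x - c)) - moser_profile \<epsilon> R (norm (y - c))\<bar> powr p
          / norm (x - y) powr (real n + s * p)) \<partial>lborel) \<partial>lborel)
      \<le> ennreal (gamma_const s n * ln (R / \<epsilon>) + C)"
proof -
  obtain C where C: "0 < C" and le:
    "\<And>(u :: real ^ 'n \<Rightarrow> real) \<epsilon> R. \<lbrakk>u \<in> borel_measurable borel; 0 < \<epsilon>; \<epsilon> \<le> R;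
      \<And>x y. x \<noteq> 0 \<Longrightarrow> y \<noteq> 0 \<Longrightarrow> \<bar>u y - u x\<bar> powr p \<le> \<bar>ln (norm y / norm x)\<bar> powr p;
      \<And>x y. x \<noteq> 0 \<Longrightarrow> y \<noteq> 0 \<Longrightarrow> norm x < \<epsilon> \<Longrightarrow> \<bar>u y - u x\<bar> powr p \<le>
        \<bar>ln (norm y / norm x)\<bar> powr p * exp (\<bar>ln (norm y / norm x)\<bar> / 2) * (norm x / \<epsilon>) powr (1 / 2);
      \<And>x y. x \<noteq> 0 \<Longrightarrow> y \<noteq> 0 \<Longrightarrow> R < norm x \<Longrightarrow> \<bar>u y - u x\<bar> powr p \<le>
        \<bar>ln (norm y / norm x)\<bar> powr p * exp (\<bar>ln (norm y / norm x)\<bar> / 2) * (R / norm x) powr (1 / 2)\<rbrakk>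
    \<Longrightarrow> (\<integral>\<^sup>+x. (\<integral>\<^sup>+y. ennreal (\<bar>u y - u x\<bar> powr p / norm (y - x) ^ (2 * n)) \<partial>lborel) \<partial>lborel)
      \<le> ennreal (gamma_const s n * ln (R / \<epsilon>) + C)"
    using gagliardo_log_radial_le[OF n s p(1)] by blast
  show thesis
  proof (rule that[OF C])
    fix \<epsilon> R :: real and c :: "real ^ 'n"
    assume \<epsilon>: "0 < \<epsilon>" "\<epsilon> \<le> R"
    let ?u = "\<lambda>x :: real ^ 'n. moser_profile \<epsilon> R (norm x)"
    let ?F = "\<lambda>x y. ennreal (\<bar>?u x - ?u y\<bar> powr p / norm (x - y) ^ (2 * n))"
    \<comment> \<open>For \<open>z = 0\<close> both sides are 0, the right one because the exponent
      is positive.\<close>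
    have k: "norm z powr (real n + s * p) = norm z ^ (2 * n)" for z :: "real ^ 'n"
    proof -
      have "real n + s * p = real (2 * n)" using p(1) by simp
      then show ?thesis using n by (cases "z = 0") (simp_all add: powr_realpow del: of_nat_mult)
    qed
    have "(\<integral>\<^sup>+y. (\<integral>\<^sup>+x. ennreal (\<bar>moser_profile \<epsilon> R (norm (x - c)) - moser_profile \<epsilon> R (norm (y - c))\<bar> powr p
          / norm (x - y) powr (real n + s * p)) \<partial>lborel) \<partial>lborel)
      = (\<integral>\<^sup>+y. (\<integral>\<^sup>+x. ?F (x - c) (y - c) \<partial>lborel) \<partial>lborel)"
      unfolding k by simp
    also have "\<dots> = (\<integral>\<^sup>+y. (\<integral>\<^sup>+x. ?F x (y - c) \<partial>lborel) \<partial>lborel)"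
      by (intro nn_integral_cong nn_integral_lborel_shift) measurable
    also have "\<dots> = (\<integral>\<^sup>+y. (\<integral>\<^sup>+x. ?F x y \<partial>lborel) \<partial>lborel)"
      by (rule nn_integral_lborel_shift[where f = "\<lambda>y. \<integral>\<^sup>+x. ?F x y \<partial>lborel"]) measurable
    also have "\<dots> \<le> ennreal (gamma_const s n * ln (R / \<epsilon>) + C)"
      using \<epsilon> p(2) by (intro le moser_profile_diff_powr_le) auto
    finally show "(\<integral>\<^sup>+y. (\<integral>\<^sup>+x. ennreal (\<bar>moser_profile \<epsilon> R (norm (x - c)) - moser_profile \<epsilon> R (norm (y - c))\<bar> powr p
          / norm (x - y) powr (real n + s * p)) \<partial>lborel) \<partial>lborel)
      \<le> ennreal (gamma_const s n * ln (R / \<epsilon>) + C)" .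
  qed
qed

text \<open>One function per level \<open>N\<close> serves both suprema, as the constraint with
  weight \<open>l\<close> also forces the seminorm below 1. The gain is that \<open>\<kappa>\<close>
  is chosen before \<open>N\<close>: the exponential always outweighs the volume of the ball by the
  same factor.\<close>

lemma concentrating_functions:
  fixes \<Omega> :: "(real ^ 'n) set"
  assumes \<Omega>: "\<Omega> \<noteq> {}" "open \<Omega>" and s: "0 < s" "s < 1" and p: "1 < p" "s * p = real CARD('n)" and l: "0 < l"
  obtains \<kappa> where "0 < \<kappa>" and
    "\<And>N. \<exists>v \<epsilon> c. v \<in> test_functions \<Omega> \<and> v \<in> sobolev_space s p \<and> gagliardo_seminorm s p v \<le> 1 \<and>
      ennreal l * epowr (Lp_norm p v) p + epowr (gagliardo_seminorm s p v) p \<le> 1 \<and>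
      0 < \<epsilon> \<and> ball c \<epsilon> \<subseteq> \<Omega> \<and>
      (\<forall>x\<in>ball c \<epsilon>. N \<le> \<bar>v x\<bar> \<and>
        N \<le> alpha_star s CARD('n) * \<bar>v x\<bar> powr (real CARD('n) / (real CARD('n) - s)) \<and>
        \<kappa> / \<epsilon> ^ CARD('n) \<le> exp (alpha_star s CARD('n) * \<bar>v x\<bar> powr (real CARD('n) / (real CARD('n) - s))))"
proof -
  define n where "n = CARD('n)"
  have n0: "0 < n" "1 \<le> real n" by (simp_all add: n_def)
  have sp: "s * p = real n" using p by (simp add: n_def)
  have sn: "s < real n" using s n0 by simp
  define \<gamma> where "\<gamma> = gamma_const s n"
  have \<gamma>: "0 < \<gamma>" unfolding \<gamma>_def by (rule gamma_const_pos[OF n0(1) s sp])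
  obtain c where "c \<in> \<Omega>" using \<Omega> by auto
  then obtain R where R: "0 < R" "cball c R \<subseteq> \<Omega>" using \<Omega>(2) open_contains_cball by blast
  obtain C where C: "0 < C" and gag: "\<And>\<epsilon> R (c :: real ^ 'n). 0 < \<epsilon> \<Longrightarrow> \<epsilon> \<le> R \<Longrightarrow>
      (\<integral>\<^sup>+y. (\<integral>\<^sup>+x. ennreal (\<bar>moser_profile \<epsilon> R (norm (x - c)) - moser_profile \<epsilon> R (norm (y - c))\<bar> powr p
          / norm (x - y) powr (real n + s * p)) \<partial>lborel) \<partial>lborel)
      \<le> ennreal (gamma_const s n * ln (R / \<epsilon>) + C)"
    using nn_integral_gagliardo_moser_profile_le[OF n_def s sp p(1)] by blast
  obtain C' where C': "0 \<le> C'" and Lp: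
    "\<And>\<epsilon>. 0 < \<epsilon> \<Longrightarrow> (\<integral>\<^sup>+(x :: real ^ 'n). ennreal (moser_profile \<epsilon> R (norm x) powr p) \<partial>lborel) \<le> ennreal C'"
    using moser_profile_Lp_le[OF n_def _ R(1), of p] p by auto
  \<comment> \<open>The whole constrained quantity of the unnormalised function is at most
    \<open>\<gamma> * L + D\<close>: \<open>C\<close> comes from the seminorm and
    \<open>l * C'\<close> from the penalty.\<close>
  define D where "D = C + l * C'"
  have D: "0 < D" using C C' l by (simp add: D_def add_pos_nonneg)
  \<comment> \<open>\<open>K\<close> is the loss in \<open>exp_moser_ge\<close>, and
    \<open>\<kappa>\<close> is chosen so that \<open>\<epsilon> = R * exp (- L)\<close> gives
    \<open>\<kappa> / \<epsilon> ^ n = exp (n * L - K)\<close>.\<close>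
  define K where "K = real n * (2 + 2 * (s / (real n - s)) * (2 * \<gamma> + D) / \<gamma>)"
  define \<kappa> where "\<kappa> = R ^ n * exp (- K)"
  have alpha: "alpha_star s n = real n * \<gamma> powr (s / (real n - s))" by (simp add: alpha_star_def \<gamma>_def)
  have ip: "1 / p = s / real n" using sp s p by (simp add: field_simps)
  show thesis
  proof (rule that[of \<kappa>])
    show "0 < \<kappa>" using R by (simp add: \<kappa>_def)
    fix N :: real
    have "eventually (\<lambda>L. N \<le> (L - 2) / (\<gamma> * L + D) powr (1 / p)) at_top"
      using filterlim_moser_height[OF \<gamma>, of D "1 / p"] D p unfolding filterlim_at_top by auto
    moreover have "eventually (\<lambda>L. 2 < L) (at_top :: real filter)" by (rule eventually_gt_at_top)
    \<comment> \<open>This makes the exponent \<open>n * L - K\<close> at least \<open>N\<close>;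
      the next condition is the one on \<open>L\<close> in \<open>growth_estimate\<close>.\<close>
    moreover have "eventually (\<lambda>L. (N + K) / real n \<le> L) (at_top :: real filter)" by (rule eventually_ge_at_top)
    moreover have "eventually (\<lambda>L. 2 * (2 * \<gamma> + D) / \<gamma> \<le> L) (at_top :: real filter)" by (rule eventually_ge_at_top)
    ultimately have "eventually (\<lambda>L. N \<le> (L - 2) / (\<gamma> * L + D) powr (1 / p) \<and> 2 < L \<and>
        (N + K) / real n \<le> L \<and> 2 * (2 * \<gamma> + D) / \<gamma> \<le> L) at_top"
      by eventually_elim simp
    then obtain L where L: "N \<le> (L - 2) / (\<gamma> * L + D) powr (1 / p)" "2 < L"
        "(N + K) / real n \<le> L" "2 * (2 * \<gamma> + D) / \<gamma> \<le> L"
      by (auto simp: eventually_at_top_linorder)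
    define \<epsilon> where "\<epsilon> = R * exp (- L)"
    have \<epsilon>: "0 < \<epsilon>" "\<epsilon> \<le> R" "\<epsilon> < R" using R L by (simp_all add: \<epsilon>_def)
    have lnL: "ln (R / \<epsilon>) = L" using R by (simp add: \<epsilon>_def ln_div ln_mult)
    define A where "A = \<gamma> * L + D"
    have A: "0 < A" using \<gamma> L D by (simp add: A_def add_pos_pos)
    \<comment> \<open>Chosen so that \<open>a powr p = 1 / A\<close>, which brings the bound on the
      constrained quantity to exactly 1.\<close>
    define a where "a = 1 / A powr (1 / p)"
    have a: "0 < a" using A by (simp add: a_def)
    have ap: "a powr p = 1 / A" using A p by (simp add: a_def powr_divide powr_powr)
    define u where "u = (\<lambda>x. moser_profile \<epsilon> R (norm (x - c)))"
    define v where "v = (\<lambda>x. a * u x)"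
    have [measurable]: "u \<in> borel_measurable borel" "v \<in> borel_measurable borel"
      unfolding u_def v_def by measurable
    have u0: "0 \<le> u x" for x by (simp add: u_def moser_profile_nonneg)

    have "closure {x. v x \<noteq> 0} \<subseteq> cball c R"
    proof (rule closure_minimal)
      show "{x. v x \<noteq> 0} \<subseteq> cball c R"
      proof
        fix x assume "x \<in> {x. v x \<noteq> 0}"
        then have "norm (x - c) < R"
          using \<epsilon> R moser_profile_eq_0[of \<epsilon> R "norm (x - c)"] by (force simp: v_def u_def)
        then show "x \<in> cball c R" by (simp add: dist_norm norm_minus_commute)
      qed
    qed simp
    moreover have "C_diff k v" for k
      unfolding v_def u_def using \<epsilon> R by (intro C_diff_moser_algebra[OF _ _ moser_algebra_profile]) auto
    moreover have "compact (closure {x. v x \<noteq> 0})"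
      using bounded_subset[OF bounded_cball calculation(1)] by (simp add: compact_eq_bounded_closed)
    ultimately have test: "v \<in> test_functions \<Omega>"
      using R by (auto simp: test_functions_def)

    let ?E = "\<integral>\<^sup>+ y. (\<integral>\<^sup>+ x. ennreal (\<bar>v x - v y\<bar> powr p / norm (x - y) powr (real CARD('n) + s * p))
              \<partial>lebesgue) \<partial>lebesgue"
    let ?P = "\<integral>\<^sup>+ x. ennreal (\<bar>v x\<bar> powr p) \<partial>lebesgue"
    have "?E = (\<integral>\<^sup>+ y. (\<integral>\<^sup>+ x. ennreal (1 / A) * ennreal (\<bar>u x - u y\<bar> powr p / norm (x - y) powr (real n + s * p))
              \<partial>lborel) \<partial>lborel)"
    proof -
      have "\<bar>v x - v y\<bar> powr p = 1 / A * \<bar>u x - u y\<bar> powr p" for x y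
        using a by (simp add: v_def right_diff_distrib[symmetric] abs_mult powr_mult ap)
      then show ?thesis
        using A by (simp add: nn_integral_completion n_def ennreal_mult[symmetric])
    qed
    also have "\<dots> = (\<integral>\<^sup>+ y. ennreal (1 / A) * (\<integral>\<^sup>+ x. ennreal (\<bar>u x - u y\<bar> powr p / norm (x - y) powr (real n + s * p))
              \<partial>lborel) \<partial>lborel)"
      by (intro nn_integral_cong nn_integral_cmult) measurable
    also have "\<dots> = ennreal (1 / A) * (\<integral>\<^sup>+ y. (\<integral>\<^sup>+ x. ennreal (\<bar>u x - u y\<bar> powr p / norm (x - y) powr (real n + s * p))
              \<partial>lborel) \<partial>lborel)"
      by (rule nn_integral_cmult) measurable
    also have "\<dots> \<le> ennreal (1 / A) * ennreal (\<gamma> * L + C)"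
      using gag[of \<epsilon> R c] \<epsilon> unfolding u_def lnL \<gamma>_def by (intro mult_left_mono) auto
    also have "\<dots> = ennreal ((\<gamma> * L + C) / A)"
      using A \<gamma> L C by (subst ennreal_mult[symmetric]) auto
    finally have E: "?E \<le> ennreal ((\<gamma> * L + C) / A)" .

    have "?P = (\<integral>\<^sup>+ x. ennreal (1 / A) * ennreal (u x powr p) \<partial>lborel)"
      using a A u0 by (simp add: nn_integral_completion v_def abs_mult powr_mult ap ennreal_mult[symmetric])
    also have "\<dots> = ennreal (1 / A) * (\<integral>\<^sup>+ x. ennreal (u x powr p) \<partial>lborel)"
      by (rule nn_integral_cmult) measurable
    also have "(\<integral>\<^sup>+ x. ennreal (u x powr p) \<partial>lborel) = (\<integral>\<^sup>+ (x :: real ^ 'n). ennreal (moser_profile \<epsilon> R (norm x) powr p) \<partial>lborel)"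
      unfolding u_def
      by (rule nn_integral_lborel_shift) measurable
    also have "ennreal (1 / A) * \<dots> \<le> ennreal (1 / A) * ennreal C'"
      by (intro mult_left_mono Lp \<epsilon>) auto
    also have "\<dots> = ennreal (C' / A)"
      using A C' by (subst ennreal_mult[symmetric]) auto
    finally have P: "?P \<le> ennreal (C' / A)" .

    have p0: "0 < p" using p by simp
    have Lpn: "epowr (Lp_norm p v) p = ?P" unfolding Lp_norm_def by (rule epowr_inverse[OF p0])
    have Gn: "epowr (gagliardo_seminorm s p v) p = ?E" unfolding gagliardo_seminorm_def by (rule epowr_inverse[OF p0])
    have "ennreal l * ?P + ?E \<le> ennreal l * ennreal (C' / A) + ennreal ((\<gamma> * L + C) / A)"
      by (intro add_mono mult_left_mono E P) auto
    also have "\<dots> = ennreal (l * (C' / A) + (\<gamma> * L + C) / A)"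
      using l A C' \<gamma> L C by (simp add: ennreal_mult[symmetric] ennreal_plus[symmetric] del: ennreal_plus)
    also have "l * (C' / A) + (\<gamma> * L + C) / A = 1"
      using A by (simp add: A_def D_def add_divide_distrib[symmetric])
    finally have constraint: "ennreal l * ?P + ?E \<le> 1" by simp
    then have E1: "?E \<le> 1" by (meson add_increasing le_zero_eq order_trans zero_le order_refl)
    have gag1: "gagliardo_seminorm s p v \<le> 1"
      unfolding gagliardo_seminorm_def using p0 E1 by (intro epowr_le_1) auto
    have "?P < \<infinity>" using P by (rule le_less_trans) simp
    moreover have "?E < \<infinity>" using E by (rule le_less_trans) simp
    moreover have "v \<in> borel_measurable lebesgue" by (simp add: measurable_completion)
    ultimately have sob: "v \<in> sobolev_space s p"
      unfolding sobolev_space_def Lp_norm_def gagliardo_seminorm_def mem_Collect_eq epowr_less_top_iff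
      by blast

    have low: "N \<le> \<bar>v x\<bar> \<and>
        N \<le> alpha_star s CARD('n) * \<bar>v x\<bar> powr (real CARD('n) / (real CARD('n) - s)) \<and>
        \<kappa> / \<epsilon> ^ CARD('n) \<le> exp (alpha_star s CARD('n) * \<bar>v x\<bar> powr (real CARD('n) / (real CARD('n) - s)))"
      if "x \<in> ball c \<epsilon>" for x
    proof -
      have "L - 2 \<le> u x"
        using moser_profile_ge[of \<epsilon> R "norm (x - c)"] \<epsilon> R that
        by (simp add: u_def lnL dist_norm norm_minus_commute)
      then have v1: "(L - 2) / A powr (1 / p) \<le> \<bar>v x\<bar>"
        using a A u0[of x] by (simp add: v_def a_def abs_mult divide_right_mono)
      have "2 * (2 * \<gamma> + D) \<le> \<gamma> * L + D"
        using L(4) \<gamma> D by (simp add: divide_le_eq mult.commute)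
      then have "real n * L - K \<le> alpha_star s n * \<bar>v x\<bar> powr (real n / (real n - s))"
        unfolding alpha K_def using v1 \<gamma> D s sn L(2) unfolding ip A_def
        by (intro exp_moser_ge) auto
      moreover have "N \<le> real n * L - K"
        using L(3) n0 by (simp add: divide_le_eq mult.commute)
      moreover have "\<kappa> / \<epsilon> ^ n = exp (real n * L - K)"
        using R by (simp add: \<kappa>_def \<epsilon>_def power_mult_distrib exp_of_nat_mult[symmetric] exp_minus exp_diff field_simps)
      moreover have "N \<le> \<bar>v x\<bar>" using L(1) v1 unfolding A_def by linarith
      ultimately show ?thesis unfolding n_def[symmetric] by simp
    qed
    have "ball c \<epsilon> \<subseteq> \<Omega>" using R \<epsilon> by (auto simp: subset_eq)
    then show "\<exists>v \<epsilon> c. v \<in> test_functions \<Omega> \<and> v \<in> sobolev_space s p \<and> gagliardo_seminorm s p v \<le> 1 \<and>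
      ennreal l * epowr (Lp_norm p v) p + epowr (gagliardo_seminorm s p v) p \<le> 1 \<and>
      0 < \<epsilon> \<and> ball c \<epsilon> \<subseteq> \<Omega> \<and>
      (\<forall>x\<in>ball c \<epsilon>. N \<le> \<bar>v x\<bar> \<and>
        N \<le> alpha_star s CARD('n) * \<bar>v x\<bar> powr (real CARD('n) / (real CARD('n) - s)) \<and>
        \<kappa> / \<epsilon> ^ CARD('n) \<le> exp (alpha_star s CARD('n) * \<bar>v x\<bar> powr (real CARD('n) / (real CARD('n) - s))))"
      using test sob gag1 constraint low \<epsilon>(1) unfolding Lpn[symmetric] Gn[symmetric]
      by (intro exI[of _ v] exI[of _ \<epsilon>] exI[of _ c] conjI ballI) auto
  qed
qed

section \<open>From the concentrating family to infinite suprema\<close>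

lemma test_functions_tilde0:
  assumes "0 < p" "v \<in> test_functions \<Omega>" "v \<in> sobolev_space s p"
  shows "v \<in> sobolev_space_tilde0 s p \<Omega>"
proof -
  have "sobolev_norm s p (\<lambda>x. v x - v x) = 0"
    using assms(1) by (simp add: sobolev_norm_def Lp_norm_def gagliardo_seminorm_def epowr_def)
  then show ?thesis using assms by (auto simp: sobolev_space_tilde0_def intro!: bexI[of _ v])
qed

lemma SUP_eq_top_if_unbounded:
  fixes F :: "'a \<Rightarrow> ennreal"
  assumes c: "0 < c" and "\<And>M. 0 \<le> M \<Longrightarrow> \<exists>u\<in>S. ennreal (M * c) \<le> F u"
  shows "(SUP u\<in>S. F u) = \<infinity>"
proof (rule ccontr)
  assume "(SUP u\<in>S. F u) \<noteq> \<infinity>"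
  then obtain r where r: "(SUP u\<in>S. F u) = ennreal r" "0 \<le> r"
    by (cases "SUP u\<in>S. F u") auto
  obtain u where "u \<in> S" "ennreal ((r + 1) / c * c) \<le> F u"
    using assms(2)[of "(r + 1) / c"] c r by auto
  then have "ennreal (r + 1) \<le> ennreal r"
    using c SUP_upper[of u S F] unfolding r(1) by (simp add: order_trans)
  then show False using r by simp
qed

text \<open>The radius cancels against the volume of the ball, so the lower bound is not lost as the
  functions concentrate.\<close>

lemma nn_integral_ge_on_ball:
  fixes F :: "real ^ 'n \<Rightarrow> ennreal"
  assumes "0 < \<epsilon>" "0 \<le> b" and "\<And>x. x \<in> ball c \<epsilon> \<Longrightarrow> ennreal (b / \<epsilon> ^ CARD('n)) \<le> F x"
  shows "ennreal (b * unit_ball_vol (real CARD('n))) \<le> (\<integral>\<^sup>+x. F x \<partial>lebesgue)"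
proof -
  have "ennreal (b * unit_ball_vol (real CARD('n)))
      = ennreal (b / \<epsilon> ^ CARD('n)) * emeasure lborel (ball c \<epsilon> :: (real ^ 'n) set)"
    using assms by (simp add: emeasure_ball ennreal_mult[symmetric])
  also have "\<dots> = (\<integral>\<^sup>+x. ennreal (b / \<epsilon> ^ CARD('n)) * indicator (ball c \<epsilon>) x \<partial>lborel)"
    by (simp add: nn_integral_cmult_indicator)
  also have "\<dots> = (\<integral>\<^sup>+x. ennreal (b / \<epsilon> ^ CARD('n)) * indicator (ball c \<epsilon>) x \<partial>lebesgue)"
    by (simp add: nn_integral_completion)
  also have "\<dots> \<le> (\<integral>\<^sup>+x. F x \<partial>lebesgue)"
    by (intro nn_integral_mono) (simp add: indicator_def assms(3))
  finally show ?thesis .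
qed

theorem theorem1p6:
  fixes \<Omega> :: "(real ^ 'n) set" and s p l :: real and f :: "real \<Rightarrow> real"
  assumes "\<Omega> \<noteq> {}" and "open \<Omega>" and "bounded \<Omega>"
    and "0 < s" and "s < 1" and "1 < p" and "s * p = real CARD('n)"
    and "f \<in> borel_measurable (restrict_space borel {0..})"
    and "\<And>t. t \<ge> 0 \<Longrightarrow> f t \<ge> 0"
    and "filterlim f at_top at_top"
    and "l > 0"
  shows "(SUP u\<in>{u \<in> sobolev_space_tilde0 s p \<Omega>. gagliardo_seminorm s p u \<le> 1}.
            \<integral>\<^sup>+ x\<in>\<Omega>. ennreal (f \<bar>u x\<bar> *
              exp (alpha_star s CARD('n) * \<bar>u x\<bar> powr (real CARD('n) / (real CARD('n) - s)))) \<partial>lebesgue) = \<infinity>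
       \<and> (SUP u\<in>{u :: real ^ 'n \<Rightarrow> real. u \<in> sobolev_space s p \<and>
              ennreal l * epowr (Lp_norm p u) p + epowr (gagliardo_seminorm s p u) p \<le> 1}.
            \<integral>\<^sup>+ x. ennreal (f \<bar>u x\<bar> *
              Psi p (alpha_star s CARD('n) * \<bar>u x\<bar> powr (real CARD('n) / (real CARD('n) - s)))) \<partial>lebesgue) = \<infinity>"
proof -
  let ?V = "unit_ball_vol (real CARD('n))"
  let ?e = "\<lambda>u x. alpha_star s CARD('n) * \<bar>u x\<bar> powr (real CARD('n) / (real CARD('n) - s))"
  obtain \<kappa> where \<kappa>: "0 < \<kappa>" and conc: "\<And>N. \<exists>v \<epsilon> c. v \<in> test_functions \<Omega> \<and> v \<in> sobolev_space s p \<and>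
      gagliardo_seminorm s p v \<le> 1 \<and>
      ennreal l * epowr (Lp_norm p v) p + epowr (gagliardo_seminorm s p v) p \<le> 1 \<and>
      0 < \<epsilon> \<and> ball c \<epsilon> \<subseteq> \<Omega> \<and>
      (\<forall>x\<in>ball c \<epsilon>. N \<le> \<bar>v x\<bar> \<and> N \<le> ?e v x \<and> \<kappa> / \<epsilon> ^ CARD('n) \<le> exp (?e v x))"
    using concentrating_functions[OF assms(1,2,4,5,6,7) assms(11)] by blast
  have f_large: "\<exists>N. \<forall>t\<ge>N. M \<le> f t" for M
    using assms(10) unfolding filterlim_at_top eventually_at_top_linorder by blast
  obtain X where X: "\<And>x. X \<le> x \<Longrightarrow> exp x / 2 \<le> Psi p x"
    using Psi_ge_half_exp[of p] unfolding eventually_at_top_linorder by blast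
  \<comment> \<open>The half is the price of replacing \<open>exp\<close> by \<open>Psi\<close>;
    with it the same lower bound holds for both integrals.\<close>
  have c: "0 < \<kappa> / 2 * ?V" using \<kappa> by simp
  have "\<exists>v. v \<in> sobolev_space_tilde0 s p \<Omega> \<and> v \<in> sobolev_space s p \<and> gagliardo_seminorm s p v \<le> 1 \<and>
      ennreal l * epowr (Lp_norm p v) p + epowr (gagliardo_seminorm s p v) p \<le> 1 \<and>
      ennreal (M * (\<kappa> / 2 * ?V)) \<le> (\<integral>\<^sup>+ x\<in>\<Omega>. ennreal (f \<bar>v x\<bar> * exp (?e v x)) \<partial>lebesgue) \<and>
      ennreal (M * (\<kappa> / 2 * ?V)) \<le> (\<integral>\<^sup>+ x. ennreal (f \<bar>v x\<bar> * Psi p (?e v x)) \<partial>lebesgue)"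
    if M: "0 \<le> M" for M
  proof -
    obtain T where T: "\<And>t. T \<le> t \<Longrightarrow> M \<le> f t" using f_large by blast
    \<comment> \<open>Two thresholds are met at once: \<open>T\<close> for the argument of
      \<open>f\<close> and \<open>X\<close> for the argument of \<open>Psi\<close>.\<close>
    obtain v \<epsilon> c where v: "v \<in> test_functions \<Omega>" "v \<in> sobolev_space s p" "gagliardo_seminorm s p v \<le> 1"
      "ennreal l * epowr (Lp_norm p v) p + epowr (gagliardo_seminorm s p v) p \<le> 1"
      and \<epsilon>: "0 < \<epsilon>" "ball c \<epsilon> \<subseteq> \<Omega>"
      and low: "\<And>x. x \<in> ball c \<epsilon> \<Longrightarrow> max T X \<le> \<bar>v x\<bar> \<and> max T X \<le> ?e v x \<and> \<kappa> / \<epsilon> ^ CARD('n) \<le> exp (?e v x)"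
      using conc[of "max T X"] by blast
    have pt: "ennreal (M * (\<kappa> / 2) / \<epsilon> ^ CARD('n)) \<le> ennreal (f \<bar>v x\<bar> * exp (?e v x))"
      "ennreal (M * (\<kappa> / 2) / \<epsilon> ^ CARD('n)) \<le> ennreal (f \<bar>v x\<bar> * Psi p (?e v x))" if x: "x \<in> ball c \<epsilon>" for x
    proof -
      have f: "M \<le> f \<bar>v x\<bar>" using low[OF x] T by simp
      have e: "\<kappa> / 2 / \<epsilon> ^ CARD('n) \<le> exp (?e v x) / 2" using low[OF x] by simp
      also have Psi: "exp (?e v x) / 2 \<le> Psi p (?e v x)" using low[OF x] by (intro X) simp
      finally have "M * (\<kappa> / 2 / \<epsilon> ^ CARD('n)) \<le> f \<bar>v x\<bar> * Psi p (?e v x)"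
        using f M \<kappa> \<epsilon> by (intro mult_mono) auto
      then show "ennreal (M * (\<kappa> / 2) / \<epsilon> ^ CARD('n)) \<le> ennreal (f \<bar>v x\<bar> * Psi p (?e v x))"
        by (intro ennreal_leI) simp
      have "exp (?e v x) / 2 \<le> exp (?e v x)" by simp
      with e have "\<kappa> / 2 / \<epsilon> ^ CARD('n) \<le> exp (?e v x)" by (rule order_trans)
      then have "M * (\<kappa> / 2 / \<epsilon> ^ CARD('n)) \<le> f \<bar>v x\<bar> * exp (?e v x)"
        using f M \<kappa> \<epsilon> by (intro mult_mono) auto
      then show "ennreal (M * (\<kappa> / 2) / \<epsilon> ^ CARD('n)) \<le> ennreal (f \<bar>v x\<bar> * exp (?e v x))"
        by (intro ennreal_leI) simp
    qed
    have b: "0 \<le> M * (\<kappa> / 2)" using M \<kappa> by simp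
    have "ennreal (M * (\<kappa> / 2) * ?V) \<le> (\<integral>\<^sup>+ x\<in>\<Omega>. ennreal (f \<bar>v x\<bar> * exp (?e v x)) \<partial>lebesgue)"
      by (rule nn_integral_ge_on_ball[OF \<epsilon>(1) b]) (use pt(1) \<epsilon>(2) in auto)
    moreover have "ennreal (M * (\<kappa> / 2) * ?V) \<le> (\<integral>\<^sup>+ x. ennreal (f \<bar>v x\<bar> * Psi p (?e v x)) \<partial>lebesgue)"
      by (rule nn_integral_ge_on_ball[OF \<epsilon>(1) b pt(2)])
    moreover have "v \<in> sobolev_space_tilde0 s p \<Omega>"
      using assms(6) v by (intro test_functions_tilde0) auto
    ultimately show ?thesis using v unfolding mult.assoc by blast
  qed
  then show ?thesis
    by (intro conjI SUP_eq_top_if_unbounded[OF c]) blast+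
qed

end
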